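(* Let $\mathrm{UT}\mathbb{H}^2_{\mathrm{Coefs}}=\{[a:b:c:d]\in\mathbb{RP}^3\mid\Delta_3(a,b,c,d)<0\}$ be the set of real cubics with exactly one real root, and $\mathrm{UT}\mathbb{H}^2_{\mathrm{Roots}}=\{\{r,z,\overline z\}\mid r\in\mathbb{RP}^1,\ z\in\mathbb{C}\setminus\mathbb{R}\}$ the set of their root-sets. Equip each with its $\mathrm{PSL}(2;\mathbb{R})$-invariant Riemannian metric described in the context (identifying them with the unit tangent bundle to the hyperbolic plane). Then the roots map $\mathcal{R}\colon\mathrm{UT}\mathbb{H}^2_{\mathrm{Coefs}}\to\mathrm{UT}\mathbb{H}^2_{\mathrm{Roots}}$, sending a cubic to its set of roots, is an isometry.
   Context: $\Delta_3$ is the discriminant of the binary cubic $ax^3+bx^2y+cxy^2+dy^3$; roots are taken in $\mathbb{CP}^1=\mathbb{C}\cup\{\infty\}$ ($[z:1]\leftrightarrow z$, $[1:0]\leftrightarrow\infty$). $\mathrm{PSL}(2;\mathbb{R})$ acts freely and transitively on $\mathrm{UT}\mathbb{H}^2_{\mathrm{Coefs}}$ by $A\cdot[f]=[f\circ A^{-1}]$ and on $\mathrm{UT}\mathbb{H}^2_{\mathrm{Roots}}$ by applying the Möbius transformation to each root. Metric on $\mathrm{UT}\mathbb{H}^2_{\mathrm{Roots}}$: points are written as pairs $\{r,z\}$ with $r\in\mathbb{RP}^1$ and $z$ in the upper half plane, so that tangent vectors at a point with $r\in\mathbb{R}$ are pairs $\{u,v\}$ with $u\in\mathbb{R}$, $v\in\mathbb{C}$.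 At the basepoint $\{0,i\}$ set $\|\{u,v\}\|^2=u^2+|v|^2$, and translate this inner product to all tangent spaces by the $\mathrm{PSL}(2;\mathbb{R})$ action. Metric on $\mathrm{UT}\mathbb{H}^2_{\mathrm{Coefs}}$: in the affine patch $[1:a:b:c]$ of monic cubics, tangent vectors are triples $(u,v,w)$, corresponding to infinitesimal variations $ux^2+vx+w$. At the basepoint $x(x^2+1)$, i.e. $[1:0:1:0]$, set $\|(u,v,w)\|^2=\left(\frac{u-w}{2}\right)^2+\left(\frac{v}{2}\right)^2+w^2$, and translate this inner product to all tangent spaces by the $\mathrm{PSL}(2;\mathbb{R})$ action. *)

theory Defs
  imports "HOL-Analysis.Analysis"
begin

section \<open>Manifolds given by an explicit atlas\<close>

type_synonym ('a, 'e) chart = "'a set \<times> ('a \<Rightarrow> 'e)"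

abbreviation chart_dom :: "('a, 'e) chart \<Rightarrow> 'a set" where
  "chart_dom \<equiv> fst"

abbreviation chart_fun :: "('a, 'e) chart \<Rightarrow> 'a \<Rightarrow> 'e" where
  "chart_fun \<equiv> snd"

definition chart_inv :: "('a, 'e) chart \<Rightarrow> 'e \<Rightarrow> 'a" where
  "chart_inv c = inv_into (chart_dom c) (chart_fun c)"

text \<open>\<open>Ck_on k S f\<close> is meant for open \<open>S\<close>: all iterated directional derivatives of \<open>f\<close>
  up to order \<open>k\<close> exist and are continuous on \<open>S\<close>.\<close>

primrec Ck_on :: "nat \<Rightarrow> 'e::euclidean_space set \<Rightarrow> ('e \<Rightarrow> 'f::euclidean_space) \<Rightarrow> bool" where
  "Ck_on 0 S = (\<lambda>f. continuous_on S f)"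
| "Ck_on (Suc k) S = (\<lambda>f. (\<forall>x\<in>S. f differentiable (at x)) \<and>
     (\<forall>v. Ck_on k S (\<lambda>x. frechet_derivative f (at x) v)))"

definition smooth_on :: "'e::euclidean_space set \<Rightarrow> ('e \<Rightarrow> 'f::euclidean_space) \<Rightarrow> bool" where
  "smooth_on S f \<longleftrightarrow> (\<forall>k. Ck_on k S f)"

definition smooth_map ::
  "'a set \<Rightarrow> ('a, 'e::euclidean_space) chart set \<Rightarrow> ('b, 'f::euclidean_space) chart set \<Rightarrow>
   ('a \<Rightarrow> 'b) \<Rightarrow> bool" where
  "smooth_map M A B f \<longleftrightarrow>
     (\<forall>p\<in>M. \<exists>c\<in>A. \<exists>d\<in>B. \<exists>W. p \<in> chart_dom c \<and> open W \<and> chart_fun c p \<in> W \<and>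
        W \<subseteq> chart_fun c ` chart_dom c \<and>
        (\<forall>x\<in>W. f (chart_inv c x) \<in> chart_dom d) \<and>
        smooth_on W (chart_fun d \<circ> f \<circ> chart_inv c))"

definition diffeomorphism ::
  "'a set \<Rightarrow> ('a, 'e::euclidean_space) chart set \<Rightarrow>
   'b set \<Rightarrow> ('b, 'f::euclidean_space) chart set \<Rightarrow> ('a \<Rightarrow> 'b) \<Rightarrow> bool" where
  "diffeomorphism M A N B f \<longleftrightarrow>
     bij_betw f M N \<and> smooth_map M A B f \<and> smooth_map N B A (inv_into M f)"

text \<open>A tangent vector at \<open>p\<close> is the family of its coordinate vectors in all charts around \<open>p\<close>,
  related by the derivatives of the transition maps; by convention it is \<open>0\<close> at all other
  charts.\<close>

type_synonym ('a, 'e) tangent = "('a, 'e) chart \<Rightarrow> 'e"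

definition charts_at :: "('a, 'e) chart set \<Rightarrow> 'a \<Rightarrow> ('a, 'e) chart set" where
  "charts_at A p = {c \<in> A. p \<in> chart_dom c}"

definition tangent_space ::
  "('a, 'e::euclidean_space) chart set \<Rightarrow> 'a \<Rightarrow> ('a, 'e) tangent set" where
  "tangent_space A p = {\<xi>.
     (\<forall>c\<in>charts_at A p. \<forall>d\<in>charts_at A p.
        \<xi> d = frechet_derivative (chart_fun d \<circ> chart_inv c) (at (chart_fun c p)) (\<xi> c)) \<and>
     (\<forall>c. c \<notin> charts_at A p \<longrightarrow> \<xi> c = 0)}"

text \<open>The result of \<open>differential\<close> does not depend on the selected chart around \<open>p\<close> when \<open>\<xi>\<close> is
  a tangent vector at \<open>p\<close> and \<open>f\<close> is smooth.\<close>

definition differential ::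
  "('a, 'e::euclidean_space) chart set \<Rightarrow> ('b, 'f::euclidean_space) chart set \<Rightarrow>
   ('a \<Rightarrow> 'b) \<Rightarrow> 'a \<Rightarrow> ('a, 'e) tangent \<Rightarrow> ('b, 'f) tangent" where
  "differential A B f p \<xi> = (\<lambda>d. if d \<in> charts_at B (f p) then
     (let c = (SOME c. c \<in> charts_at A p) in
       frechet_derivative (chart_fun d \<circ> f \<circ> chart_inv c) (at (chart_fun c p)) (\<xi> c))
     else 0)"

type_synonym ('a, 'e) metric = "'a \<Rightarrow> ('a, 'e) tangent \<Rightarrow> ('a, 'e) tangent \<Rightarrow> real"

definition riemannian_isometry ::
  "'a set \<Rightarrow> ('a, 'e::euclidean_space) chart set \<Rightarrow> ('a, 'e) metric \<Rightarrow>
   'b set \<Rightarrow> ('b, 'f::euclidean_space) chart set \<Rightarrow> ('b, 'f) metric \<Rightarrow> ('a \<Rightarrow> 'b) \<Rightarrow> bool" where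
  "riemannian_isometry M A g N B h f \<longleftrightarrow>
     diffeomorphism M A N B f \<and>
     (\<forall>p\<in>M. \<forall>\<xi>\<in>tangent_space A p. \<forall>\<eta>\<in>tangent_space A p.
        h (f p) (differential A B f p \<xi>) (differential A B f p \<eta>) = g p \<xi> \<eta>)"

text \<open>Given a simply transitive action of a group \<open>'g\<close>, an inner product on the tangent space at
  the basepoint is moved to \<open>p\<close> along the unique group element carrying \<open>p\<close> to the basepoint.\<close>

definition translated_metric ::
  "('a, 'e::euclidean_space) chart set \<Rightarrow> ('g \<Rightarrow> 'a \<Rightarrow> 'a) \<Rightarrow> 'a \<Rightarrow>
   (('a, 'e) tangent \<Rightarrow> ('a, 'e) tangent \<Rightarrow> real) \<Rightarrow> ('a, 'e) metric" where
  "translated_metric A act base ip p \<xi> \<eta> =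
     (let T = (THE T. act T p = base)
      in ip (differential A A (act T) p \<xi>) (differential A A (act T) p \<eta>))"


section \<open>The group, the projective spaces, and binary cubics\<close>

definition sl2_rel :: "real^2^2 \<Rightarrow> real^2^2 \<Rightarrow> bool" where
  "sl2_rel S T \<longleftrightarrow> det S = 1 \<and> (T = S \<or> T = - S)"

lemma det_uminus_2: "det (- S) = det (S :: real^2^2)"
  by (simp add: det_2)

lemma sl2_rel_part_equivp: "part_equivp sl2_rel"
proof (rule part_equivpI)
  show "\<exists>S. sl2_rel S S"
    by (rule exI[of _ "mat 1"]) (simp add: sl2_rel_def)
  show "symp sl2_rel"
    by (rule sympI) (auto simp: sl2_rel_def det_uminus_2)
  show "transp sl2_rel"
    by (rule transpI) (auto simp: sl2_rel_def)
qed

quotient_type psl2r = "real^2^2" / partial: sl2_rel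
  by (rule sl2_rel_part_equivp)

definition cp1_rel :: "complex \<times> complex \<Rightarrow> complex \<times> complex \<Rightarrow> bool" where
  "cp1_rel = (\<lambda>(x, y) (x', y'). (x, y) \<noteq> (0, 0) \<and> (\<exists>t. t \<noteq> 0 \<and> x' = t * x \<and> y' = t * y))"

lemma cp1_rel_part_equivp: "part_equivp cp1_rel"
proof (rule part_equivpI)
  show "\<exists>v. cp1_rel v v"
    by (rule exI[of _ "(1, 0)"]) (auto simp: cp1_rel_def intro!: exI[of _ 1])
  show "symp cp1_rel"
  proof (rule sympI)
    fix v w assume "cp1_rel v w"
    then obtain x y t where *: "v = (x, y)" "w = (t * x, t * y)" "(x, y) \<noteq> (0, 0)" "t \<noteq> 0"
      by (auto simp: cp1_rel_def)
    then show "cp1_rel w v"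
      by (auto simp: cp1_rel_def intro!: exI[of _ "1 / t"])
  qed
  show "transp cp1_rel"
  proof (rule transpI)
    fix u v w assume "cp1_rel u v" "cp1_rel v w"
    then obtain x y t s where "u = (x, y)" "w = (s * (t * x), s * (t * y))"
        "(x, y) \<noteq> (0, 0)" "t \<noteq> 0" "s \<noteq> 0"
      by (auto simp: cp1_rel_def)
    then show "cp1_rel u w"
      by (auto simp: cp1_rel_def intro!: exI[of _ "s * t"])
  qed
qed

quotient_type cp1 = "complex \<times> complex" / partial: cp1_rel morphisms rep_CP1 CP1
  by (rule cp1_rel_part_equivp)

definition cp1_of :: "complex \<Rightarrow> cp1" where
  "cp1_of z = CP1 (z, 1)"

definition cp1_inf :: cp1 where
  "cp1_inf = CP1 (1, 0)"

definition RP1 :: "cp1 set" where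
  "RP1 = {CP1 (of_real x, of_real y) | x y. (x, y) \<noteq> (0, 0)}"

type_synonym coefs = "real \<times> real \<times> real \<times> real"

definition rp3_rel :: "coefs \<Rightarrow> coefs \<Rightarrow> bool" where
  "rp3_rel q q' \<longleftrightarrow> q \<noteq> 0 \<and> (\<exists>t. t \<noteq> 0 \<and> q' = t *\<^sub>R q)"

lemma rp3_rel_part_equivp: "part_equivp rp3_rel"
proof (rule part_equivpI)
  show "\<exists>q. rp3_rel q q"
    by (rule exI[of _ "(1, 0, 0, 0)"])
      (auto simp: rp3_rel_def zero_prod_def intro!: exI[of _ 1])
  show "symp rp3_rel"
  proof (rule sympI)
    fix q q' assume "rp3_rel q q'"
    then obtain t where "q' = t *\<^sub>R q" "q \<noteq> 0" "t \<noteq> 0"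
      by (auto simp: rp3_rel_def)
    then show "rp3_rel q' q"
      by (auto simp: rp3_rel_def intro!: exI[of _ "1 / t"])
  qed
  show "transp rp3_rel"
    by (rule transpI) (auto simp: rp3_rel_def, metis mult_eq_0_iff scaleR_scaleR)
qed

quotient_type rp3 = coefs / partial: rp3_rel morphisms rep_RP3 RP3
  by (rule rp3_rel_part_equivp)

text \<open>The binary cubic \<open>a x\<^sup>3 + b x\<^sup>2 y + c x y\<^sup>2 + d y\<^sup>3\<close> has coefficient vector
  \<open>(a, b, c, d)\<close>.\<close>

fun binary_cubic :: "coefs \<Rightarrow> complex \<Rightarrow> complex \<Rightarrow> complex" where
  "binary_cubic (a, b, c, d) x y =
     of_real a * x ^ 3 + of_real b * x ^ 2 * y + of_real c * x * y ^ 2 + of_real d * y ^ 3"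

definition cubic_disc :: "real \<Rightarrow> real \<Rightarrow> real \<Rightarrow> real \<Rightarrow> real" where
  "cubic_disc a b c d =
     b\<^sup>2 * c\<^sup>2 - 4 * a * c ^ 3 - 4 * b ^ 3 * d - 27 * a\<^sup>2 * d\<^sup>2 + 18 * a * b * c * d"

text \<open>Coefficients of the cubic \<open>f \<circ> S\<close>, where \<open>S\<close> acts linearly on \<open>(x, y)\<close>; this is verified
  in \<open>binary_cubic_subst\<close>.\<close>

definition cubic_subst :: "real^2^2 \<Rightarrow> coefs \<Rightarrow> coefs" where
  "cubic_subst S = (\<lambda>(a, b, c, d).
     let k = S$1$1; l = S$1$2; m = S$2$1; n = S$2$2 in
     (a * k ^ 3 + b * k\<^sup>2 * m + c * k * m\<^sup>2 + d * m ^ 3,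
      3 * a * k\<^sup>2 * l + b * (k\<^sup>2 * n + 2 * k * l * m) + c * (2 * k * m * n + l * m\<^sup>2)
        + 3 * d * m\<^sup>2 * n,
      3 * a * k * l\<^sup>2 + b * (2 * k * l * n + l\<^sup>2 * m) + c * (k * n\<^sup>2 + 2 * l * m * n)
        + 3 * d * m * n\<^sup>2,
      a * l ^ 3 + b * l\<^sup>2 * n + c * l * n\<^sup>2 + d * n ^ 3))"

lemma binary_cubic_subst:
  "binary_cubic (cubic_subst S q) x y =
     binary_cubic q (of_real (S$1$1) * x + of_real (S$1$2) * y)
                    (of_real (S$2$1) * x + of_real (S$2$2) * y)"
  by (cases q)
    (simp add: cubic_subst_def Let_def algebra_simps power2_eq_square power3_eq_cube)

lemma cubic_subst_scaleR: "cubic_subst S (t *\<^sub>R q) = t *\<^sub>R cubic_subst S q"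
  by (cases q) (simp add: cubic_subst_def Let_def algebra_simps)

lemma cubic_subst_uminus: "cubic_subst (- S) q = - cubic_subst S q"
  by (cases q) (simp add: cubic_subst_def Let_def algebra_simps)

lemma cubic_subst_cubic_subst: "cubic_subst T (cubic_subst S q) = cubic_subst (S ** T) q"
  by (cases q)
    (simp add: cubic_subst_def Let_def matrix_matrix_mult_def sum_2 algebra_simps
      power2_eq_square power3_eq_cube)

lemma cubic_subst_mat_1: "cubic_subst (mat 1) q = q"
  by (cases q) (simp add: cubic_subst_def Let_def mat_def)

lemma cubic_subst_nonzero:
  assumes "invertible S" "q \<noteq> 0"
  shows "cubic_subst S q \<noteq> 0"
proof
  assume eq: "cubic_subst S q = 0"
  obtain T where "S ** T = mat 1"
    using assms(1) by (auto simp: invertible_def)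
  then have "q = cubic_subst T (cubic_subst S q)"
    by (simp add: cubic_subst_cubic_subst cubic_subst_mat_1)
  also have "\<dots> = 0"
    using cubic_subst_scaleR[of T 0 0] by (simp add: eq)
  finally show False
    using assms(2) by simp
qed

lemma matrix_inv_inverse:
  fixes S :: "real^2^2"
  assumes "invertible S"
  shows "S ** matrix_inv S = mat 1" "matrix_inv S ** S = mat 1"
proof -
  have "\<exists>T. S ** T = mat 1 \<and> T ** S = mat 1"
    using assms by (simp add: invertible_def)
  from someI_ex[OF this] show "S ** matrix_inv S = mat 1" "matrix_inv S ** S = mat 1"
    by (simp_all add: matrix_inv_def)
qed

lemma invertible_matrix_inv:
  fixes S :: "real^2^2"
  assumes "invertible S"
  shows "invertible (matrix_inv S)"
  using matrix_inv_inverse[OF assms] by (auto simp: invertible_def[of "matrix_inv S"])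

lemma matrix_inv_uminus:
  fixes S :: "real^2^2"
  assumes "invertible S"
  shows "matrix_inv (- S) = - matrix_inv S"
proof -
  have neg: "- P ** - Q = P ** Q" for P Q :: "real^2^2"
    by (simp add: matrix_matrix_mult_def)
  have inv: "- S ** - matrix_inv S = mat 1" "- matrix_inv S ** - S = mat 1"
    by (simp_all add: neg matrix_inv_inverse[OF assms])
  then have "invertible (- S)"
    by (auto simp: invertible_def)
  then have left: "matrix_inv (- S) ** - S = mat 1"
    by (rule matrix_inv_inverse)
  have "matrix_inv (- S) = matrix_inv (- S) ** (- S ** - matrix_inv S)"
    by (simp only: inv matrix_mul_rid)
  also have "\<dots> = - matrix_inv S"
    by (simp only: matrix_mul_assoc left matrix_mul_lid)
  finally show ?thesis .
qed


section \<open>Cubics with exactly one real root\<close>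

definition UTH2_Coefs :: "rp3 set" where
  "UTH2_Coefs = {RP3 (a, b, c, d) | a b c d. cubic_disc a b c d < 0}"

lift_definition aff_a :: "rp3 \<Rightarrow> real \<times> real \<times> real" is "\<lambda>(a, b, c, d). (b / a, c / a, d / a)"
  by (auto simp: rp3_rel_def)
lift_definition aff_b :: "rp3 \<Rightarrow> real \<times> real \<times> real" is "\<lambda>(a, b, c, d). (a / b, c / b, d / b)"
  by (auto simp: rp3_rel_def)
lift_definition aff_c :: "rp3 \<Rightarrow> real \<times> real \<times> real" is "\<lambda>(a, b, c, d). (a / c, b / c, d / c)"
  by (auto simp: rp3_rel_def)
lift_definition aff_d :: "rp3 \<Rightarrow> real \<times> real \<times> real" is "\<lambda>(a, b, c, d). (a / d, b / d, c / d)"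
  by (auto simp: rp3_rel_def)

definition monic_chart :: "(rp3, real \<times> real \<times> real) chart" where
  "monic_chart = ({RP3 (a, b, c, d) | a b c d. cubic_disc a b c d < 0 \<and> a \<noteq> 0}, aff_a)"

definition coefs_atlas :: "(rp3, real \<times> real \<times> real) chart set" where
  "coefs_atlas =
    {monic_chart,
     ({RP3 (a, b, c, d) | a b c d. cubic_disc a b c d < 0 \<and> b \<noteq> 0}, aff_b),
     ({RP3 (a, b, c, d) | a b c d. cubic_disc a b c d < 0 \<and> c \<noteq> 0}, aff_c),
     ({RP3 (a, b, c, d) | a b c d. cubic_disc a b c d < 0 \<and> d \<noteq> 0}, aff_d)}"

lift_definition coefs_act :: "psl2r \<Rightarrow> rp3 \<Rightarrow> rp3" is "\<lambda>S q. cubic_subst (matrix_inv S) q"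
proof -
  fix S T :: "real^2^2" and q q' :: coefs
  assume ST: "sl2_rel S T" and q: "rp3_rel q q'"
  obtain t where t: "t \<noteq> 0" "q' = t *\<^sub>R q" "q \<noteq> 0"
    using q by (auto simp: rp3_rel_def)
  have inv: "invertible S"
    using ST by (simp add: sl2_rel_def invertible_det_nz)
  have nz: "cubic_subst (matrix_inv S) q \<noteq> 0"
    using cubic_subst_nonzero[OF invertible_matrix_inv[OF inv] t(3)] .
  show "rp3_rel (cubic_subst (matrix_inv S) q) (cubic_subst (matrix_inv T) q')"
  proof (cases "T = S")
    case True
    then show ?thesis
      using t nz by (auto simp: rp3_rel_def cubic_subst_scaleR)
  next
    case False
    then have "matrix_inv T = - matrix_inv S"
      using ST matrix_inv_uminus[OF inv] by (simp add: sl2_rel_def)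
    then have "cubic_subst (matrix_inv T) q' = (- t) *\<^sub>R cubic_subst (matrix_inv S) q"
      by (simp add: t(2) cubic_subst_scaleR cubic_subst_uminus)
    then show ?thesis
      using t(1) nz unfolding rp3_rel_def by (metis neg_equal_0_iff_equal)
  qed
qed

definition coefs_base :: rp3 where
  "coefs_base = RP3 (1, 0, 1, 0)"

text \<open>The polarization of the quadratic form in \<open>coefs_inner_self\<close>.\<close>

fun coefs_inner :: "real \<times> real \<times> real \<Rightarrow> real \<times> real \<times> real \<Rightarrow> real" where
  "coefs_inner (u, v, w) (u', v', w') =
     ((u - w) / 2) * ((u' - w') / 2) + (v / 2) * (v' / 2) + w * w'"

lemma coefs_inner_self: "coefs_inner (u, v, w) (u, v, w) = ((u - w) / 2)\<^sup>2 + (v / 2)\<^sup>2 + w\<^sup>2"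
  by (simp add: power2_eq_square)

definition coefs_metric :: "(rp3, real \<times> real \<times> real) metric" where
  "coefs_metric = translated_metric coefs_atlas coefs_act coefs_base
     (\<lambda>\<xi> \<eta>. coefs_inner (\<xi> monic_chart) (\<eta> monic_chart))"


section \<open>Root sets\<close>

definition UTH2_Roots :: "cp1 set set" where
  "UTH2_Roots = {{r, cp1_of z, cp1_of (cnj z)} | r z. r \<in> RP1 \<and> z \<notin> \<real>}"

text \<open>A root set is determined by its real point \<open>r\<close> and its point \<open>z\<close> in the upper half plane;
  this identifies \<open>UTH2_Roots\<close> with the product of \<open>RP1\<close> and the upper half plane.\<close>

definition real_root :: "cp1 set \<Rightarrow> cp1" where
  "real_root s = (THE r. r \<in> s \<and> r \<in> RP1)"

definition upper_root :: "cp1 set \<Rightarrow> complex" where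
  "upper_root s = (THE z. cp1_of z \<in> s \<and> Im z > 0)"

lift_definition aff_x :: "cp1 \<Rightarrow> complex" is "\<lambda>(x, y). x / y"
  by (auto simp: cp1_rel_def)
lift_definition aff_y :: "cp1 \<Rightarrow> complex" is "\<lambda>(x, y). y / x"
  by (auto simp: cp1_rel_def)

definition finite_chart :: "(cp1 set, real \<times> complex) chart" where
  "finite_chart = ({s \<in> UTH2_Roots. real_root s \<noteq> cp1_inf},
     \<lambda>s. (Re (aff_x (real_root s)), upper_root s))"

definition infinite_chart :: "(cp1 set, real \<times> complex) chart" where
  "infinite_chart = ({s \<in> UTH2_Roots. real_root s \<noteq> cp1_of 0},
     \<lambda>s. (Re (aff_y (real_root s)), upper_root s))"

definition roots_atlas :: "(cp1 set, real \<times> complex) chart set" where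
  "roots_atlas = {finite_chart, infinite_chart}"

lift_definition moebius :: "psl2r \<Rightarrow> cp1 \<Rightarrow> cp1" is
  "\<lambda>S (x, y). (of_real (S$1$1) * x + of_real (S$1$2) * y, of_real (S$2$1) * x + of_real (S$2$2) * y)"
proof -
  fix S T :: "real^2^2" and v w :: "complex \<times> complex"
  let ?m = "\<lambda>S (x, y). (complex_of_real (S$1$1) * x + complex_of_real (S$1$2) * y,
                      complex_of_real (S$2$1) * x + complex_of_real (S$2$2) * y)"
  assume ST: "sl2_rel S T" and vw: "cp1_rel v w"
  obtain x y t where v: "v = (x, y)" "w = (t * x, t * y)" "(x, y) \<noteq> (0, 0)" "t \<noteq> 0"
    using vw by (auto simp: cp1_rel_def)
  obtain e :: complex where e: "e \<noteq> 0" "\<And>i j. of_real (T$i$j) = e * of_real (S$i$j)"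
  proof (cases "T = S")
    case True
    then show ?thesis using that[of 1] by simp
  next
    case False
    then show ?thesis using ST that[of "-1"] by (simp add: sl2_rel_def)
  qed
  define k l m n where "k = complex_of_real (S$1$1)" "l = complex_of_real (S$1$2)"
    "m = complex_of_real (S$2$1)" "n = complex_of_real (S$2$2)"
  have "complex_of_real (det S) = 1"
    using ST by (simp add: sl2_rel_def)
  then have det: "k * n - l * m = 1"
    by (simp add: det_2 k_l_m_n_def)
  have "(k * x + l * y, m * x + n * y) \<noteq> (0, 0)"
  proof
    assume "(k * x + l * y, m * x + n * y) = (0, 0)"
    then have eq: "k * x + l * y = 0" "m * x + n * y = 0"
      by auto
    have "x = (k * n - l * m) * x" "y = (k * n - l * m) * y"
      using det by simp_all
    moreover have "(k * n - l * m) * x = n * (k * x + l * y) - l * (m * x + n * y)"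
      "(k * n - l * m) * y = k * (m * x + n * y) - m * (k * x + l * y)"
      by (simp_all add: algebra_simps)
    ultimately show False
      using eq v(3) by simp
  qed
  then show "cp1_rel (?m S v) (?m T w)"
    using v e by (auto simp: cp1_rel_def k_l_m_n_def algebra_simps intro!: exI[of _ "e * t"])
qed

definition roots_act :: "psl2r \<Rightarrow> cp1 set \<Rightarrow> cp1 set" where
  "roots_act T s = moebius T ` s"

definition roots_base :: "cp1 set" where
  "roots_base = {cp1_of 0, cp1_of \<i>, cp1_of (- \<i>)}"

text \<open>The inner product of \<open>real \<times> complex\<close> is the one inducing \<open>u\<^sup>2 + \<bar>v\<bar>\<^sup>2\<close>.\<close>

lemma roots_inner_self: "inner (u, v) (u, v) = u\<^sup>2 + (cmod v)\<^sup>2" for u :: real and v :: complex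
  by (simp add: power2_norm_eq_inner) (simp add: power2_eq_square)

definition roots_metric :: "(cp1 set, real \<times> complex) metric" where
  "roots_metric = translated_metric roots_atlas roots_act roots_base
     (\<lambda>\<xi> \<eta>. inner (\<xi> finite_chart) (\<eta> finite_chart))"


section \<open>The roots map\<close>

lift_definition is_root :: "rp3 \<Rightarrow> cp1 \<Rightarrow> bool" is "\<lambda>q (x, y). binary_cubic q x y = 0"
proof -
  fix q q' :: coefs and v v' :: "complex \<times> complex"
  assume "rp3_rel q q'" "cp1_rel v v'"
  then obtain a b c d s x y t where *: "q = (a, b, c, d)" "q' = s *\<^sub>R q" "s \<noteq> 0"
      "v = (x, y)" "v' = (t * x, t * y)" "t \<noteq> 0"
    by (cases q; cases v) (auto simp: rp3_rel_def cp1_rel_def)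
  have "binary_cubic q' (t * x) (t * y) = of_real s * t ^ 3 * binary_cubic q x y"
    by (simp add: * algebra_simps power2_eq_square power3_eq_cube)
  then show "(case v of (x, y) \<Rightarrow> binary_cubic q x y = 0) =
      (case v' of (x, y) \<Rightarrow> binary_cubic q' x y = 0)"
    using * by simp
qed

definition roots_map :: "rp3 \<Rightarrow> cp1 set" where
  "roots_map q = {P. is_root q P}"

end

theory Submission
  imports Defs
begin

text \<open>Both metrics are translated from the basepoint, and the roots map is equivariant, so by the chain
  rule it suffices to compare the two inner products at the basepoint. There the derivative of the
  roots map is explicit: perturbing \<open>x (x\<^sup>2 + 1)\<close> by \<open>u x\<^sup>2 + v x + w\<close> moves the root \<open>0\<close> by \<open>- w\<close> and
  the root \<open>\<i>\<close> by \<open>(w - u) / 2 + \<i> v / 2\<close>. Equivariance also propagates smoothness from the basepoint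
  to all charts.\<close>

text \<open>The translated metrics are defined through the unique \<open>T\<close> that carries a
  point to the basepoint, so they cannot be evaluated before simple transitivity is known. That is
  proved for root sets, where the conditions on the matrix become linear apart from the determinant,
  and it reaches cubics through the bijection. \<open>differential\<close> evaluates in a chart
  chosen by \<open>SOME\<close>; hence smoothness must be available for every pair of charts, not
  only for a convenient one. The other obstacle is the roots map itself: it has no convenient
  formula in the coefficients, whereas its inverse merely multiplies out linear factors. So the
  bijection comes from parametrizing both spaces by the same root data, the inverse is smooth
  because it is polynomial, and the roots map is differentiated as the inverse of Vieta's formulas,
  with invariance of domain supplying the continuity that this requires. Both spaces are quotients
  of open sets, so the actions and the inverse of the roots map are handled by polynomial or
  rational lifts to homogeneous coordinates.\<close>

section \<open>Smooth functions\<close>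

text \<open>An algebra of functions in which a differential system for the generators can be
  expressed. If differentiating the generators never leaves it, then no derivative of any order
  does. Rule \<open>cong\<close> is there because the formulas for \<open>frechet_derivative\<close>
  hold only at points of \<open>S\<close>.\<close>

inductive_set rational_closure :: "'e::euclidean_space set \<Rightarrow> ('e \<Rightarrow> real) set \<Rightarrow> ('e \<Rightarrow> real) set"
  for S G where
  generator: "g \<in> G \<Longrightarrow> g \<in> rational_closure S G"
| const: "(\<lambda>x. c) \<in> rational_closure S G"
| add: "f \<in> rational_closure S G \<Longrightarrow> g \<in> rational_closure S G \<Longrightarrow>
    (\<lambda>x. f x + g x) \<in> rational_closure S G"
| mult: "f \<in> rational_closure S G \<Longrightarrow> g \<in> rational_closure S G \<Longrightarrow>
    (\<lambda>x. f x * g x) \<in> rational_closure S G"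
| inverse: "f \<in> rational_closure S G \<Longrightarrow> (\<And>x. x \<in> S \<Longrightarrow> f x \<noteq> 0) \<Longrightarrow>
    (\<lambda>x. inverse (f x)) \<in> rational_closure S G"
| cong: "f \<in> rational_closure S G \<Longrightarrow> (\<And>x. x \<in> S \<Longrightarrow> f x = g x) \<Longrightarrow> g \<in> rational_closure S G"

lemma rational_closure_uminus:
  "f \<in> rational_closure S G \<Longrightarrow> (\<lambda>x. - f x) \<in> rational_closure S G"
  using rational_closure.mult[OF rational_closure.const[of "-1"]] by simp

lemma rational_closure_diff:
  "f \<in> rational_closure S G \<Longrightarrow> g \<in> rational_closure S G \<Longrightarrow>
    (\<lambda>x. f x - g x) \<in> rational_closure S G"
  using rational_closure.add[OF _ rational_closure_uminus] by fastforce

lemma rational_closure_divide: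
  "f \<in> rational_closure S G \<Longrightarrow> g \<in> rational_closure S G \<Longrightarrow> (\<And>x. x \<in> S \<Longrightarrow> g x \<noteq> 0) \<Longrightarrow>
    (\<lambda>x. f x / g x) \<in> rational_closure S G"
  using rational_closure.mult[OF _ rational_closure.inverse] by (fastforce simp: divide_inverse)

lemma rational_closure_power:
  "f \<in> rational_closure S G \<Longrightarrow> (\<lambda>x. f x ^ n) \<in> rational_closure S G"
  by (induction n) (auto intro: rational_closure.const rational_closure.mult)

lemma rational_closure_sum:
  "(\<And>i. i \<in> I \<Longrightarrow> f i \<in> rational_closure S G) \<Longrightarrow> (\<lambda>x. \<Sum>i\<in>I. f i x) \<in> rational_closure S G"
  by (induction I rule: infinite_finite_induct)
    (auto intro: rational_closure.const rational_closure.add)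

text \<open>The sum, product and reciprocal rules express the derivative of a compound function
  through its parts and their derivatives, all of which lie in the closure; so only the generators
  have to be checked.\<close>

lemma rational_closure_derivative:
  assumes S: "open S"
    and diff: "\<And>g x. g \<in> G \<Longrightarrow> x \<in> S \<Longrightarrow> g differentiable (at x)"
    and der: "\<And>g v. g \<in> G \<Longrightarrow> (\<lambda>x. frechet_derivative g (at x) v) \<in> rational_closure S G"
    and f: "f \<in> rational_closure S G"
  shows "(\<forall>x\<in>S. f differentiable (at x)) \<and>
    (\<forall>v. (\<lambda>x. frechet_derivative f (at x) v) \<in> rational_closure S G)"
  using f
proof induction
  case (generator g)
  then show ?case using diff der by blast
next
  case (const c)
  then show ?case by (auto intro: rational_closure.const)
next
  case (add f g)
  have "(\<lambda>x. frechet_derivative (\<lambda>x. f x + g x) (at x) v) \<in> rational_closure S G" for v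
  proof (rule rational_closure.cong)
    show "(\<lambda>x. frechet_derivative f (at x) v + frechet_derivative g (at x) v) \<in> rational_closure S G"
      using add by (auto intro: rational_closure.add)
    fix x assume "x \<in> S"
    then have "((\<lambda>x. f x + g x) has_derivative
        (\<lambda>v. frechet_derivative f (at x) v + frechet_derivative g (at x) v)) (at x)"
      using add by (intro has_derivative_add) (auto simp: frechet_derivative_works)
    from frechet_derivative_at[OF this]
    show "frechet_derivative f (at x) v + frechet_derivative g (at x) v =
      frechet_derivative (\<lambda>x. f x + g x) (at x) v" by metis
  qed
  then show ?case using add by auto
next
  case (mult f g)
  have "(\<lambda>x. frechet_derivative (\<lambda>x. f x * g x) (at x) v) \<in> rational_closure S G" for v
  proof (rule rational_closure.cong)
    show "(\<lambda>x. f x * frechet_derivative g (at x) v + frechet_derivative f (at x) v * g x)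
        \<in> rational_closure S G"
      using mult by (intro rational_closure.add rational_closure.mult) auto
    fix x assume "x \<in> S"
    then have "((\<lambda>x. f x * g x) has_derivative
        (\<lambda>v. f x * frechet_derivative g (at x) v + frechet_derivative f (at x) v * g x)) (at x)"
      using mult by (intro has_derivative_mult) (auto simp: frechet_derivative_works)
    from frechet_derivative_at[OF this]
    show "f x * frechet_derivative g (at x) v + frechet_derivative f (at x) v * g x =
      frechet_derivative (\<lambda>x. f x * g x) (at x) v" by metis
  qed
  then show ?case using mult by auto
next
  case (inverse f)
  have "(\<lambda>x. frechet_derivative (\<lambda>x. inverse (f x)) (at x) v) \<in> rational_closure S G" for v
  proof (rule rational_closure.cong)
    show "(\<lambda>x. - (inverse (f x) * frechet_derivative f (at x) v * inverse (f x)))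
        \<in> rational_closure S G"
      using inverse by (intro rational_closure_uminus rational_closure.mult) (auto intro: rational_closure.inverse)
    fix x assume "x \<in> S"
    then have "((\<lambda>x. inverse (f x)) has_derivative
        (\<lambda>v. - (inverse (f x) * frechet_derivative f (at x) v * inverse (f x)))) (at x)"
      using inverse by (intro Deriv.has_derivative_inverse) (auto simp: frechet_derivative_works)
    from frechet_derivative_at[OF this]
    show "- (inverse (f x) * frechet_derivative f (at x) v * inverse (f x)) =
      frechet_derivative (\<lambda>x. inverse (f x)) (at x) v" by metis
  qed
  then show ?case using inverse by (auto intro!: differentiable_inverse)
next
  case (cong f g)
  have d: "(g has_derivative frechet_derivative f (at x)) (at x)" if "x \<in> S" for x
    using cong that S
    by (auto intro: has_derivative_transform_within_open[of f _ x UNIV S] simp: frechet_derivative_works)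
  have "(\<lambda>x. frechet_derivative g (at x) v) \<in> rational_closure S G" for v
  proof (rule rational_closure.cong)
    show "(\<lambda>x. frechet_derivative f (at x) v) \<in> rational_closure S G"
      using cong by blast
    show "frechet_derivative f (at x) v = frechet_derivative g (at x) v" if "x \<in> S" for x
      using frechet_derivative_at[OF d[OF that]] by simp
  qed
  then show ?case using d by (auto simp: differentiable_def)
qed

text \<open>The induction on the order needs no higher Leibniz formula: a directional derivative is
  again a member of the closure, and the induction hypothesis covers every member.\<close>

lemma smooth_on_rational_closure:
  assumes "open S"
    and "\<And>g x. g \<in> G \<Longrightarrow> x \<in> S \<Longrightarrow> g differentiable (at x)"
    and "\<And>g v. g \<in> G \<Longrightarrow> (\<lambda>x. frechet_derivative g (at x) v) \<in> rational_closure S G"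
    and "f \<in> rational_closure S G"
  shows "smooth_on S f"
proof -
  have "Ck_on k S f" if "f \<in> rational_closure S G" for f k
    using that
  proof (induction k arbitrary: f)
    case 0
    then show ?case
      using rational_closure_derivative[OF assms(1-3) 0]
      by (auto intro!: continuous_at_imp_continuous_on differentiable_imp_continuous_within)
  next
    case (Suc k)
    then show ?case
      using rational_closure_derivative[OF assms(1-3) Suc.prems] by auto
  qed
  with assms(4) show ?thesis by (simp add: smooth_on_def)
qed

section \<open>Calculus of \<open>smooth_on\<close>: locality, components, algebra,
  composition\<close>

lemma smooth_on_imp_differentiable:
  "smooth_on S f \<Longrightarrow> x \<in> S \<Longrightarrow> f differentiable (at x)"
  using Ck_on.simps(2)[of 0 S] unfolding smooth_on_def by metis

lemma smooth_on_imp_continuous_on: "smooth_on S f \<Longrightarrow> continuous_on S f"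
  using Ck_on.simps(1)[of S] unfolding smooth_on_def by metis

lemma smooth_on_frechet_derivative:
  "smooth_on S f \<Longrightarrow> smooth_on S (\<lambda>x. frechet_derivative f (at x) v)"
  unfolding smooth_on_def by (metis Ck_on.simps(2))

text \<open>With all smooth functions as generators, stability under differentiation is automatic,
  so \<open>smooth_on\<close> inherits sums, products and quotients from the closure.\<close>

lemma smooth_on_real_iff:
  fixes f :: "'e::euclidean_space \<Rightarrow> real"
  assumes "open S"
  shows "smooth_on S f \<longleftrightarrow> f \<in> rational_closure S {f. smooth_on S f}"
proof
  assume "f \<in> rational_closure S {f. smooth_on S f}"
  then show "smooth_on S f"
    using assms
    by (elim smooth_on_rational_closure[rotated -1])
      (auto intro: smooth_on_imp_differentiable smooth_on_frechet_derivative rational_closure.generator)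
qed (auto intro: rational_closure.generator)

lemma Ck_on_cong:
  assumes "open S" "\<And>x. x \<in> S \<Longrightarrow> f x = g x" "Ck_on k S f"
  shows "Ck_on k S g"
  using assms(2,3)
proof (induction k arbitrary: f g)
  case 0
  then show ?case using continuous_on_cong[of S S f g] by simp
next
  case (Suc k)
  have d: "(g has_derivative frechet_derivative f (at x)) (at x)" if "x \<in> S" for x
    using Suc.prems that assms(1)
    by (auto intro: has_derivative_transform_within_open[of f _ x UNIV S] simp: frechet_derivative_works)
  have "Ck_on k S (\<lambda>x. frechet_derivative g (at x) v)" for v
  proof (rule Suc.IH)
    show "Ck_on k S (\<lambda>x. frechet_derivative f (at x) v)"
      using Suc.prems by simp
    show "frechet_derivative f (at x) v = frechet_derivative g (at x) v" if "x \<in> S" for x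
      using frechet_derivative_at[OF d[OF that]] by simp
  qed
  then show ?case using d by (auto simp: differentiable_def)
qed

lemma smooth_on_cong:
  assumes "open S" "\<And>x. x \<in> S \<Longrightarrow> f x = g x" "smooth_on S f"
  shows "smooth_on S g"
  using Ck_on_cong[OF assms(1,2)] assms(3) by (simp add: smooth_on_def)

lemma Ck_on_subset: "T \<subseteq> S \<Longrightarrow> Ck_on k S f \<Longrightarrow> Ck_on k T f"
  by (induction k arbitrary: f) (auto intro: continuous_on_subset)

lemma smooth_on_subset: "T \<subseteq> S \<Longrightarrow> smooth_on S f \<Longrightarrow> smooth_on T f"
  unfolding smooth_on_def using Ck_on_subset[of T S] by blast

lemma frechet_derivative_inner_left:
  assumes "f differentiable (at x)"
  shows "frechet_derivative (\<lambda>x. f x \<bullet> b) (at x) v = frechet_derivative f (at x) v \<bullet> b"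
proof -
  have "((\<lambda>x. f x \<bullet> b) has_derivative (\<lambda>v. frechet_derivative f (at x) v \<bullet> b)) (at x)"
    using assms by (intro has_derivative_inner_left) (simp add: frechet_derivative_works)
  from frechet_derivative_at[OF this] show ?thesis by metis
qed

text \<open>Differentiation commutes with the inner product by a fixed vector. This reduces
  vector-valued maps to real-valued ones, to which the closure argument applies.\<close>

lemma Ck_on_componentwise:
  fixes f :: "'e::euclidean_space \<Rightarrow> 'f::euclidean_space"
  assumes "open S"
  shows "Ck_on k S f \<longleftrightarrow> (\<forall>b\<in>Basis. Ck_on k S (\<lambda>x. f x \<bullet> b))"
proof (induction k arbitrary: f)
  case 0
  show ?case using continuous_on_componentwise[of S f] by simp
next
  case (Suc k)
  show ?case
  proof (cases "\<forall>x\<in>S. f differentiable (at x)")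
    case True
    have "Ck_on k S (\<lambda>x. frechet_derivative f (at x) v \<bullet> b) \<longleftrightarrow>
        Ck_on k S (\<lambda>x. frechet_derivative (\<lambda>x. f x \<bullet> b) (at x) v)" for b v
      by (intro iffI; erule Ck_on_cong[OF assms, rotated])
        (use True in \<open>simp_all add: frechet_derivative_inner_left\<close>)
    moreover have "(\<lambda>x. f x \<bullet> b) differentiable (at x)" if "x \<in> S" "b \<in> Basis" for x b
      using True that differentiable_componentwise_within[of f x UNIV] by blast
    ultimately show ?thesis
      using True by (auto simp: Suc.IH)
  next
    case False
    then show ?thesis
      using differentiable_componentwise_within[of f _ UNIV] by auto
  qed
qed

lemma smooth_on_componentwise:
  fixes f :: "'e::euclidean_space \<Rightarrow> 'f::euclidean_space"
  assumes "open S"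
  shows "smooth_on S f \<longleftrightarrow> (\<forall>b\<in>Basis. smooth_on S (\<lambda>x. f x \<bullet> b))"
  using Ck_on_componentwise[OF assms] by (auto simp: smooth_on_def)

lemma smooth_on_add:
  fixes f g :: "'e::euclidean_space \<Rightarrow> real"
  assumes "open S" "smooth_on S f" "smooth_on S g"
  shows "smooth_on S (\<lambda>x. f x + g x)"
  by (rule smooth_on_real_iff[OF assms(1), THEN iffD2], rule rational_closure.add)
    (simp_all add: rational_closure.generator assms)

lemma smooth_on_diff:
  fixes f g :: "'e::euclidean_space \<Rightarrow> real"
  assumes "open S" "smooth_on S f" "smooth_on S g"
  shows "smooth_on S (\<lambda>x. f x - g x)"
  by (rule smooth_on_real_iff[OF assms(1), THEN iffD2], rule rational_closure_diff)
    (simp_all add: rational_closure.generator assms)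

lemma smooth_on_mult:
  fixes f g :: "'e::euclidean_space \<Rightarrow> real"
  assumes "open S" "smooth_on S f" "smooth_on S g"
  shows "smooth_on S (\<lambda>x. f x * g x)"
  by (rule smooth_on_real_iff[OF assms(1), THEN iffD2], rule rational_closure.mult)
    (simp_all add: rational_closure.generator assms)

lemma smooth_on_divide:
  fixes f g :: "'e::euclidean_space \<Rightarrow> real"
  assumes "open S" "smooth_on S f" "smooth_on S g" "\<And>x. x \<in> S \<Longrightarrow> g x \<noteq> 0"
  shows "smooth_on S (\<lambda>x. f x / g x)"
  by (rule smooth_on_real_iff[OF assms(1), THEN iffD2], rule rational_closure_divide)
    (simp_all add: rational_closure.generator assms)

lemma smooth_on_uminus:
  fixes f :: "'e::euclidean_space \<Rightarrow> real"
  assumes "open S" "smooth_on S f"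
  shows "smooth_on S (\<lambda>x. - f x)"
  by (rule smooth_on_real_iff[OF assms(1), THEN iffD2], rule rational_closure_uminus)
    (simp_all add: rational_closure.generator assms)

lemma smooth_on_power:
  fixes f :: "'e::euclidean_space \<Rightarrow> real"
  assumes "open S" "smooth_on S f"
  shows "smooth_on S (\<lambda>x. f x ^ n)"
  by (rule smooth_on_real_iff[OF assms(1), THEN iffD2], rule rational_closure_power)
    (simp_all add: rational_closure.generator assms)

lemma smooth_on_const: "smooth_on S (\<lambda>x. c)"
proof -
  have "Ck_on k S (\<lambda>x. c)" for k
    by (induction k arbitrary: c) (simp_all add: frechet_derivative_const)
  then show ?thesis by (simp add: smooth_on_def)
qed

lemma smooth_on_bounded_linear:
  assumes "bounded_linear f"
  shows "smooth_on S f"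
proof -
  have "Ck_on k S f" for k
  proof (cases k)
    case 0
    then show ?thesis using assms by (simp add: linear_continuous_on)
  next
    case (Suc n)
    have "frechet_derivative f (at x) = f" for x
      using frechet_derivative_at[OF bounded_linear_imp_has_derivative[OF assms]] by metis
    then show ?thesis
      using Suc smooth_on_const[of S "f _"] bounded_linear_imp_differentiable[OF assms]
      by (auto simp: smooth_on_def)
  qed
  then show ?thesis by (simp add: smooth_on_def)
qed

text \<open>The closure argument yields the chain rule in all orders at once: a derivative of
  \<open>g \<circ> f\<close> is a sum of products of a component of a derivative of \<open>f\<close>
  with a partial derivative of \<open>g\<close> composed with \<open>f\<close>, and \<open>G\<close>
  contains both kinds of factor.\<close>

lemma smooth_on_compose_real:
  fixes f :: "'e::euclidean_space \<Rightarrow> 'f::euclidean_space" and g :: "'f \<Rightarrow> real"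
  assumes S: "open S" and T: "open T" and f: "smooth_on S f" and fST: "\<And>x. x \<in> S \<Longrightarrow> f x \<in> T"
    and g: "smooth_on T g"
  shows "smooth_on S (\<lambda>x. g (f x))"
proof -
  define G :: "('e \<Rightarrow> real) set" where "G = {\<lambda>x. g (f x) | g. smooth_on T g} \<union> {h. smooth_on S h}"
  have cases: "(\<exists>g'. smooth_on T g' \<and> h = (\<lambda>x. g' (f x))) \<or> smooth_on S h" if "h \<in> G" for h
    using that by (auto simp: G_def)
  have diff: "h differentiable (at x)" if "h \<in> G" "x \<in> S" for h x
    using cases[OF that(1)]
  proof (elim disjE exE conjE)
    fix g' assume g': "smooth_on T g'" "h = (\<lambda>x. g' (f x))"
    have "f differentiable (at x)" "g' differentiable (at (f x))"
      using that f fST g' by (auto intro: smooth_on_imp_differentiable)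
    from differentiable_chain_at[OF this] show ?thesis
      by (simp add: g'(2) o_def)
  qed (use that in \<open>auto intro: smooth_on_imp_differentiable\<close>)
  have der: "(\<lambda>x. frechet_derivative h (at x) v) \<in> rational_closure S G" if "h \<in> G" for h v
    using cases[OF that]
  proof (elim disjE exE conjE)
    fix g' assume g': "smooth_on T g'" "h = (\<lambda>x. g' (f x))"
    show ?thesis
    proof (rule rational_closure.cong)
      have comp: "smooth_on S (\<lambda>x. frechet_derivative f (at x) v \<bullet> b)" if "b \<in> Basis" for b
        by (rule smooth_on_componentwise[OF S, THEN iffD1, rule_format,
            OF smooth_on_frechet_derivative[OF f] that])
      show "(\<lambda>x. \<Sum>b\<in>Basis. (frechet_derivative f (at x) v \<bullet> b) *
          frechet_derivative g' (at (f x)) b) \<in> rational_closure S G"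
        using comp smooth_on_frechet_derivative[OF g'(1)]
        by (intro rational_closure_sum rational_closure.mult rational_closure.generator)
          (auto simp: G_def)
      fix x assume x: "x \<in> S"
      have d: "f differentiable (at x)" "g' differentiable (at (f x))"
        using x g' f fST by (auto intro: smooth_on_imp_differentiable)
      have lin: "linear (frechet_derivative g' (at (f x)))"
        using d(2) by (simp add: linear_frechet_derivative)
      let ?w = "frechet_derivative f (at x) v"
      have "frechet_derivative h (at x) v = frechet_derivative g' (at (f x)) ?w"
        using frechet_derivative_compose[OF d] by (simp add: g'(2) o_def)
      also have "\<dots> = frechet_derivative g' (at (f x)) (\<Sum>b\<in>Basis. (?w \<bullet> b) *\<^sub>R b)"
        by (simp add: euclidean_representation)
      also have "\<dots> = (\<Sum>b\<in>Basis. (?w \<bullet> b) * frechet_derivative g' (at (f x)) b)"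
        using lin by (simp add: linear_sum linear_cmul)
      finally show "(\<Sum>b\<in>Basis. (?w \<bullet> b) * frechet_derivative g' (at (f x)) b) =
        frechet_derivative h (at x) v" ..
    qed
  next
    assume "smooth_on S h"
    then show ?thesis
      by (auto simp: G_def intro!: rational_closure.generator smooth_on_frechet_derivative)
  qed
  show ?thesis
  proof (rule smooth_on_rational_closure[OF S, where G=G])
    show "(\<lambda>x. g (f x)) \<in> rational_closure S G"
      using g by (auto simp: G_def intro!: rational_closure.generator)
  qed (fact diff, fact der)
qed

lemma smooth_on_compose:
  fixes f :: "'e::euclidean_space \<Rightarrow> 'f::euclidean_space" and g :: "'f \<Rightarrow> 'g::euclidean_space"
  assumes "open S" "open T" "smooth_on S f" "\<And>x. x \<in> S \<Longrightarrow> f x \<in> T" "smooth_on T g"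
  shows "smooth_on S (\<lambda>x. g (f x))"
  using assms(5) smooth_on_compose_real[OF assms(1-4)]
  unfolding smooth_on_componentwise[OF assms(1), of "\<lambda>x. g (f x)"]
    smooth_on_componentwise[OF assms(2), of g] by blast

lemma smooth_on_Pair:
  assumes "open S" "smooth_on S f" "smooth_on S g"
  shows "smooth_on S (\<lambda>x. (f x, g x))"
  using assms(2,3) smooth_on_const
  unfolding smooth_on_componentwise[OF assms(1), of f] smooth_on_componentwise[OF assms(1), of g]
    smooth_on_componentwise[OF assms(1), of "\<lambda>x. (f x, g x)"]
  by (auto simp: Basis_prod_def)

lemma smooth_on_Complex:
  assumes "open S" "smooth_on S f" "smooth_on S g"
  shows "smooth_on S (\<lambda>x. Complex (f x) (g x))"
  using assms(2,3)
  unfolding smooth_on_componentwise[OF assms(1), of "\<lambda>x. Complex (f x) (g x)"]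
  by (auto simp: Basis_complex_def)

lemma smooth_on_bounded_linear_compose:
  assumes "open S" "bounded_linear g" "smooth_on S f"
  shows "smooth_on S (\<lambda>x. g (f x))"
  using assms by (auto intro: smooth_on_compose[where T=UNIV] smooth_on_bounded_linear)

lemma smooth_on_id: "smooth_on S (\<lambda>x. x)"
  by (simp add: smooth_on_bounded_linear)

lemmas smooth_on_fst = smooth_on_bounded_linear_compose[OF _ bounded_linear_fst]
lemmas smooth_on_snd = smooth_on_bounded_linear_compose[OF _ bounded_linear_snd]
lemmas smooth_on_Re = smooth_on_bounded_linear_compose[OF _ bounded_linear_Re]
lemmas smooth_on_Im = smooth_on_bounded_linear_compose[OF _ bounded_linear_Im]

lemmas smooth_on_intros = smooth_on_const smooth_on_id smooth_on_add smooth_on_diff smooth_on_mult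
  smooth_on_uminus smooth_on_power smooth_on_divide smooth_on_Pair smooth_on_Complex
  smooth_on_fst smooth_on_snd smooth_on_Re smooth_on_Im

section \<open>Smoothness and derivatives in charts\<close>

text \<open>Both charts are prescribed, whereas \<open>smooth_map\<close> only asks for some pair.
  This stronger form is what evaluating \<open>differential\<close> in a chart chosen by
  \<open>SOME\<close> calls for.\<close>

definition smooth_in_charts ::
  "('a, 'e::euclidean_space) chart \<Rightarrow> ('b, 'f::euclidean_space) chart \<Rightarrow> ('a \<Rightarrow> 'b) \<Rightarrow> 'a \<Rightarrow> bool" where
  "smooth_in_charts c d f p \<longleftrightarrow> p \<in> chart_dom c \<and>
     (\<exists>W. open W \<and> chart_fun c p \<in> W \<and> W \<subseteq> chart_fun c ` chart_dom c \<and>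
       (\<forall>x\<in>W. f (chart_inv c x) \<in> chart_dom d) \<and> smooth_on W (chart_fun d \<circ> f \<circ> chart_inv c))"

abbreviation chart_deriv ::
  "('a, 'e::euclidean_space) chart \<Rightarrow> ('b, 'f::euclidean_space) chart \<Rightarrow> ('a \<Rightarrow> 'b) \<Rightarrow> 'a \<Rightarrow> 'e \<Rightarrow> 'f" where
  "chart_deriv c d f p \<equiv> frechet_derivative (chart_fun d \<circ> f \<circ> chart_inv c) (at (chart_fun c p))"

lemma chart_inv_chart_fun:
  "inj_on (chart_fun c) (chart_dom c) \<Longrightarrow> p \<in> chart_dom c \<Longrightarrow> chart_inv c (chart_fun c p) = p"
  by (simp add: chart_inv_def)

lemma chart_inv_in_dom: "x \<in> chart_fun c ` chart_dom c \<Longrightarrow> chart_inv c x \<in> chart_dom c"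
  by (simp add: chart_inv_def inv_into_into)

text \<open>Agreement is assumed on the chart domain only, because equivariance and cancellation of
  group elements are available only on the manifold.\<close>

lemma smooth_in_charts_transform:
  assumes "smooth_in_charts c d f p" "\<And>q. q \<in> chart_dom c \<Longrightarrow> f q = g q"
  shows "smooth_in_charts c d g p" "chart_deriv c d f p = chart_deriv c d g p"
proof -
  obtain W where W: "open W" "chart_fun c p \<in> W" "W \<subseteq> chart_fun c ` chart_dom c"
    "\<And>x. x \<in> W \<Longrightarrow> f (chart_inv c x) \<in> chart_dom d" "smooth_on W (chart_fun d \<circ> f \<circ> chart_inv c)"
    using assms(1) by (auto simp: smooth_in_charts_def)
  have eq: "f (chart_inv c x) = g (chart_inv c x)" if "x \<in> W" for x
    using assms(2)[OF chart_inv_in_dom[OF subsetD[OF W(3) that]]] .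
  have "smooth_on W (chart_fun d \<circ> g \<circ> chart_inv c)"
    by (rule smooth_on_cong[OF W(1) _ W(5)]) (simp add: eq)
  then show "smooth_in_charts c d g p"
    using W(1-4) assms(1) unfolding smooth_in_charts_def by (intro conjI exI[of _ W]) (simp_all flip: eq)
  show "chart_deriv c d f p = chart_deriv c d g p"
    by (rule frechet_derivative_transform_within_open[OF smooth_on_imp_differentiable[OF W(5,2)] W(1,2)])
      (simp add: eq)
qed

lemma smooth_in_charts_compose:
  assumes inj: "inj_on (chart_fun c) (chart_dom c)" "inj_on (chart_fun d) (chart_dom d)"
    and f: "smooth_in_charts c d f p" and g: "smooth_in_charts d e g (f p)"
  shows "smooth_in_charts c e (g \<circ> f) p"
    "chart_deriv c e (g \<circ> f) p v = chart_deriv d e g (f p) (chart_deriv c d f p v)"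
proof -
  let ?F = "chart_fun d \<circ> f \<circ> chart_inv c" and ?G = "chart_fun e \<circ> g \<circ> chart_inv d"
  obtain W where W: "open W" "chart_fun c p \<in> W" "W \<subseteq> chart_fun c ` chart_dom c"
    "\<And>x. x \<in> W \<Longrightarrow> f (chart_inv c x) \<in> chart_dom d" "smooth_on W ?F"
    using f by (auto simp: smooth_in_charts_def)
  obtain V where V: "open V" "chart_fun d (f p) \<in> V" "V \<subseteq> chart_fun d ` chart_dom d"
    "\<And>x. x \<in> V \<Longrightarrow> g (chart_inv d x) \<in> chart_dom e" "smooth_on V ?G"
    using g by (auto simp: smooth_in_charts_def)
  have p: "p \<in> chart_dom c"
    using f by (simp add: smooth_in_charts_def)
  have Fp: "?F (chart_fun c p) = chart_fun d (f p)"
    using p inj by (simp add: chart_inv_chart_fun)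
  define U where "U = W \<inter> ?F -` V"
  have U: "open U" "U \<subseteq> W"
    using continuous_open_preimage[OF smooth_on_imp_continuous_on[OF W(5)] W(1) V(1)]
    by (auto simp: U_def)
  have pU: "chart_fun c p \<in> U"
    using W V Fp by (auto simp: U_def)
  have inv: "chart_inv d (?F x) = f (chart_inv c x)" if "x \<in> U" for x
    using that W(4) U inj by (auto simp: chart_inv_chart_fun)
  have eq: "?G (?F x) = (chart_fun e \<circ> (g \<circ> f) \<circ> chart_inv c) x" if "x \<in> U" for x
    using inv[OF that] by simp
  have "smooth_on U (\<lambda>x. ?G (?F x))"
    by (rule smooth_on_compose[OF U(1) V(1) smooth_on_subset[OF U(2) W(5)] _ V(5)])
      (simp add: U_def)
  then have "smooth_on U (chart_fun e \<circ> (g \<circ> f) \<circ> chart_inv c)"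
    by (rule smooth_on_cong[OF U(1), rotated]) (rule eq)
  moreover have "(g \<circ> f) (chart_inv c x) \<in> chart_dom e" if "x \<in> U" for x
    using V(4)[of "?F x"] inv[OF that] that by (auto simp: U_def)
  ultimately show "smooth_in_charts c e (g \<circ> f) p"
    using U pU p W(3) unfolding smooth_in_charts_def by (intro conjI exI[of _ U]) auto
  have dF: "?F differentiable (at (chart_fun c p))"
    using smooth_on_imp_differentiable[OF W(5,2)] .
  have dG: "?G differentiable (at (?F (chart_fun c p)))"
    using smooth_on_imp_differentiable[OF V(5,2)] Fp by simp
  have "chart_deriv c e (g \<circ> f) p = frechet_derivative (?G \<circ> ?F) (at (chart_fun c p))"
    by (rule frechet_derivative_transform_within_open[OF differentiable_chain_at[OF dF dG] U(1) pU,
          symmetric]) (use eq in simp)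
  also have "\<dots> = chart_deriv d e g (f p) \<circ> chart_deriv c d f p"
    by (simp only: frechet_derivative_compose[OF dF dG] Fp)
  finally show "chart_deriv c e (g \<circ> f) p v = chart_deriv d e g (f p) (chart_deriv c d f p v)"
    by (simp only: o_apply)
qed

lemma differential_chart_deriv:
  assumes "charts_at A p \<noteq> {}" "d \<in> charts_at B (f p)"
  shows "differential A B f p \<xi> d =
    chart_deriv (SOME c. c \<in> charts_at A p) d f p (\<xi> (SOME c. c \<in> charts_at A p))"
  using assms by (simp add: differential_def Let_def)

section \<open>Homogeneous manifolds\<close>

text \<open>Instead of a group structure on \<open>'g\<close>, the locale records what the argument
  extracts from it: every transformation is smooth in all pairs of charts and undone by another one,
  and exactly one moves a given point to the basepoint.\<close>

locale homogeneous_manifold =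
  fixes M :: "'a set" and A :: "('a, 'e::euclidean_space) chart set"
    and act :: "'g \<Rightarrow> 'a \<Rightarrow> 'a" and base :: 'a and c0 :: "('a, 'e) chart"
  assumes inj: "c \<in> A \<Longrightarrow> inj_on (chart_fun c) (chart_dom c)"
    and dom: "c \<in> A \<Longrightarrow> chart_dom c \<subseteq> M"
    and cover: "p \<in> M \<Longrightarrow> charts_at A p \<noteq> {}"
    and base: "base \<in> M" and c0: "c0 \<in> charts_at A base"
    and act_in: "p \<in> M \<Longrightarrow> act T p \<in> M"
    and act_smooth: "c \<in> charts_at A p \<Longrightarrow> d \<in> charts_at A (act T p) \<Longrightarrow>
      smooth_in_charts c d (act T) p"
    and simply_transitive: "p \<in> M \<Longrightarrow> \<exists>!T. act T p = base"
    and act_inv: "\<exists>T'. \<forall>p\<in>M. act T' (act T p) = p"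

locale equivariant_map =
  source: homogeneous_manifold M A act base c0 + target: homogeneous_manifold N B act' base' d0
  for M :: "'a set" and A :: "('a, 'e::euclidean_space) chart set" and act :: "'g \<Rightarrow> 'a \<Rightarrow> 'a"
    and base :: 'a and c0 :: "('a, 'e) chart"
    and N :: "'b set" and B :: "('b, 'f::euclidean_space) chart set" and act' :: "'g \<Rightarrow> 'b \<Rightarrow> 'b"
    and base' :: 'b and d0 :: "('b, 'f) chart" +
  fixes f :: "'a \<Rightarrow> 'b"
  assumes maps_to: "p \<in> M \<Longrightarrow> f p \<in> N"
    and equivariant: "p \<in> M \<Longrightarrow> f (act T p) = act' T (f p)"
    and base_base: "f base = base'"
    and smooth_base: "smooth_in_charts c0 d0 f base"
begin

text \<open>If \<open>T\<close> moves \<open>p\<close> to the basepoint and \<open>T'\<close> undoes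
  \<open>T\<close>, then \<open>f\<close> agrees on \<open>M\<close> with
  \<open>act' T' \<circ> f \<circ> act T\<close>, so its behaviour at \<open>p\<close> is that at
  the basepoint between two smooth transformations.\<close>

lemma smooth:
  assumes c: "c \<in> charts_at A p" and d: "d \<in> charts_at B (f p)"
  shows "smooth_in_charts c d f p"
proof -
  have p: "p \<in> M" "c \<in> A" "d \<in> B"
    using c d source.dom[of c] by (auto simp: charts_at_def)
  obtain T where T: "act T p = base"
    using source.simply_transitive[OF p(1)] by blast
  obtain T' where T': "\<And>p. p \<in> M \<Longrightarrow> act T' (act T p) = p"
    using source.act_inv by blast
  have f_eq: "(act' T' \<circ> (f \<circ> act T)) q = f q" if "q \<in> M" for q
    using that equivariant[of "act T q" T'] source.act_in[OF that] T' by simp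
  have c0: "c0 \<in> A" and d0: "d0 \<in> B"
    using source.c0 target.c0 by (auto simp: charts_at_def)
  have 1: "smooth_in_charts c c0 (act T) p"
    using source.act_smooth c source.c0 T by simp
  have 2: "smooth_in_charts c d0 (f \<circ> act T) p"
    using smooth_in_charts_compose(1)[OF source.inj source.inj 1] p c0 smooth_base T by simp
  have "smooth_in_charts d0 d (act' T') ((f \<circ> act T) p)"
    using target.act_smooth[of d0 base' d T'] target.c0 d f_eq[OF p(1)] T base_base by simp
  then have "smooth_in_charts c d (act' T' \<circ> (f \<circ> act T)) p"
    using smooth_in_charts_compose(1)[OF source.inj target.inj 2] p d0 by blast
  then show ?thesis
    by (rule smooth_in_charts_transform(1)) (rule f_eq[OF subsetD[OF source.dom[OF p(2)]]])
qed

lemma smooth_map: "smooth_map M A B f"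
  unfolding smooth_map_def
proof
  fix p assume p: "p \<in> M"
  obtain c d where c: "c \<in> charts_at A p" and d: "d \<in> charts_at B (f p)"
    using source.cover[OF p] target.cover[OF maps_to[OF p]] by blast
  have "c \<in> A" "d \<in> B"
    using c d by (auto simp: charts_at_def)
  then show "\<exists>c\<in>A. \<exists>d\<in>B. \<exists>W. p \<in> chart_dom c \<and> open W \<and> chart_fun c p \<in> W \<and>
      W \<subseteq> chart_fun c ` chart_dom c \<and> (\<forall>x\<in>W. f (chart_inv c x) \<in> chart_dom d) \<and>
      smooth_on W (chart_fun d \<circ> f \<circ> chart_inv c)"
    using smooth[OF c d] unfolding smooth_in_charts_def by (intro bexI[of _ c] bexI[of _ d]) blast+
qed

text \<open>Differentiate \<open>act' T \<circ> f = f \<circ> act T\<close> at \<open>p\<close>: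
  pushing a vector forward by \<open>f\<close> and then translating it is the same as translating it
  and then applying the derivative of \<open>f\<close> at the basepoint, where \<open>ip\<close>
  compares the two forms. No tangency of \<open>\<xi>\<close> and \<open>\<eta>\<close> enters,
  since \<open>differential\<close> reads them in the selected chart alone.\<close>

lemma differential_isometry:
  assumes bij: "bij_betw f M N" and p: "p \<in> M"
    and ip: "\<And>u v. ip' (chart_deriv c0 d0 f base u) (chart_deriv c0 d0 f base v) = ip u v"
  shows "translated_metric B act' base' (\<lambda>\<xi> \<eta>. ip' (\<xi> d0) (\<eta> d0)) (f p)
      (differential A B f p \<xi>) (differential A B f p \<eta>) =
    translated_metric A act base (\<lambda>\<xi> \<eta>. ip (\<xi> c0) (\<eta> c0)) p \<xi> \<eta>"
proof -
  have fp: "f p \<in> N"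
    using maps_to p .
  \<comment> \<open>Injectivity of \<open>f\<close> gives the forward direction, so both metrics
    translate by the same \<open>T\<close>.\<close>
  have "act' T (f p) = base' \<longleftrightarrow> act T p = base" for T
    using bij_betw_imp_inj_on[OF bij] source.act_in[OF p] source.base
    by (metis base_base equivariant inj_onD p)
  moreover define T where "T = (THE T. act T p = base)"
  ultimately have T': "(THE T. act' T (f p) = base') = T"
    by simp
  have T: "act T p = base"
    unfolding T_def using source.simply_transitive[OF p] by (rule theI')
  have Tf: "act' T (f p) = base'"
    using T equivariant[OF p] base_base by metis
  \<comment> \<open>These are the charts that \<open>differential\<close> itself selects at
    \<open>p\<close> and \<open>f p\<close>; the outer differential therefore reads the inner one in
    the chart \<open>d\<close>.\<close>
  define c where "c = (SOME c. c \<in> charts_at A p)"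
  define d where "d = (SOME d. d \<in> charts_at B (f p))"
  have c: "c \<in> charts_at A p" and d: "d \<in> charts_at B (f p)"
    using source.cover[OF p] target.cover[OF fp] by (auto simp: c_def d_def some_in_eq)
  have mem: "c \<in> A" "d \<in> B" "c0 \<in> A" "d0 \<in> B"
    using c d source.c0 target.c0 by (auto simp: charts_at_def)
  note inj = source.inj[OF mem(1)] target.inj[OF mem(2)] source.inj[OF mem(3)] target.inj[OF mem(4)]
  have s1: "smooth_in_charts c d f p" using smooth[OF c d] .
  have s2: "smooth_in_charts d d0 (act' T) (f p)"
    using target.act_smooth[OF d] target.c0 Tf by simp
  have s3: "smooth_in_charts c c0 (act T) p"
    using source.act_smooth[OF c] source.c0 T by simp
  have s4: "smooth_in_charts c0 d0 f (act T p)"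
    using smooth_base T by simp
  have "differential B B (act' T) (f p) (differential A B f p \<zeta>) d0 =
      chart_deriv c0 d0 f base (differential A A (act T) p \<zeta> c0)" for \<zeta>
  proof -
    have "differential B B (act' T) (f p) (differential A B f p \<zeta>) d0 =
        chart_deriv d d0 (act' T) (f p) (chart_deriv c d f p (\<zeta> c))"
      using fp p target.cover source.cover target.c0 Tf d
      by (simp add: differential_chart_deriv flip: c_def d_def)
    also have "\<dots> = chart_deriv c d0 (act' T \<circ> f) p (\<zeta> c)"
      using smooth_in_charts_compose(2)[OF inj(1,2) s1 s2] ..
    also have "chart_deriv c d0 (act' T \<circ> f) p = chart_deriv c d0 (f \<circ> act T) p"
      by (rule smooth_in_charts_transform(2)[OF smooth_in_charts_compose(1)[OF inj(1,2) s1 s2]])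
        (simp add: equivariant subsetD[OF source.dom[OF mem(1)]])
    also have "\<dots> (\<zeta> c) = chart_deriv c0 d0 f base (chart_deriv c c0 (act T) p (\<zeta> c))"
      using smooth_in_charts_compose(2)[OF inj(1,3) s3 s4] T by simp
    also have "chart_deriv c c0 (act T) p (\<zeta> c) = differential A A (act T) p \<zeta> c0"
      using p source.cover source.c0 T
      by (simp add: differential_chart_deriv flip: c_def)
    finally show ?thesis .
  qed
  then show ?thesis
    by (simp add: translated_metric_def Let_def T' ip flip: T_def)
qed

end

text \<open>The inverse of an equivariant bijection is equivariant, so the same locale spreads its
  smoothness from the basepoint.\<close>

lemma (in equivariant_map) riemannian_isometry_translated_metric:
  assumes bij: "bij_betw f M N"
    and inv_base: "smooth_in_charts d0 c0 (inv_into M f) base'"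
    and ip: "\<And>u v. ip' (chart_deriv c0 d0 f base u) (chart_deriv c0 d0 f base v) = ip u v"
  shows "riemannian_isometry M A (translated_metric A act base (\<lambda>\<xi> \<eta>. ip (\<xi> c0) (\<eta> c0)))
    N B (translated_metric B act' base' (\<lambda>\<xi> \<eta>. ip' (\<xi> d0) (\<eta> d0))) f"
proof -
  let ?g = "inv_into M f"
  have g: "?g q \<in> M" "f (?g q) = q" if "q \<in> N" for q
    using bij_betw_apply[OF bij_betw_inv_into[OF bij] that] bij_betw_inv_into_right[OF bij that] .
  have gf: "?g (f p) = p" if "p \<in> M" for p
    using bij_betw_inv_into_left[OF bij that] .
  have equiv: "?g (act' T q) = act T (?g q)" if "q \<in> N" for T q
    using g[OF that] equivariant[of "?g q" T] gf source.act_in by metis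
  interpret inv: equivariant_map N B act' base' d0 M A act base c0 ?g
    by unfold_locales (use g equiv gf[OF source.base] base_base inv_base in auto)
  show ?thesis
    using bij smooth_map inv.smooth_map differential_isometry[OF bij, where ip=ip and ip'=ip'] ip
    by (simp add: riemannian_isometry_def diffeomorphism_def)
qed

section \<open>Charts of quotients\<close>

text \<open>The manifold is \<open>Q ` P\<close>; the chart lives on the part where the homogeneous coordinate
  \<open>\<kappa>\<close> does not vanish, \<open>\<pi>\<close> dehomogenizes and \<open>\<sigma>\<close> is the affine section.\<close>

locale quotient_chart =
  fixes Q :: "'h::euclidean_space \<Rightarrow> 'a" and P :: "'h set"
    and c :: "('a, 'e::euclidean_space) chart"
    and \<kappa> :: "'h \<Rightarrow> real" and \<pi> :: "'h \<Rightarrow> 'e" and \<sigma> :: "'e \<Rightarrow> 'h"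
  assumes open_P: "open P"
    and chart_dom_eq: "chart_dom c = Q ` {h \<in> P. \<kappa> h \<noteq> 0}"
    and chart_fun_eq: "h \<in> P \<Longrightarrow> \<kappa> h \<noteq> 0 \<Longrightarrow> chart_fun c (Q h) = \<pi> h"
    and section_coord: "\<kappa> (\<sigma> x) \<noteq> 0" and section_right: "\<pi> (\<sigma> x) = x"
    and section_left: "h \<in> P \<Longrightarrow> \<kappa> h \<noteq> 0 \<Longrightarrow> \<sigma> (\<pi> h) \<in> P \<and> Q (\<sigma> (\<pi> h)) = Q h"
    and coord_cong: "h \<in> P \<Longrightarrow> h' \<in> P \<Longrightarrow> Q h = Q h' \<Longrightarrow> \<kappa> h \<noteq> 0 \<Longrightarrow> \<kappa> h' \<noteq> 0"
    and continuous_coord: "continuous_on UNIV \<kappa>"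
    and smooth_section: "smooth_on UNIV \<sigma>"
    and smooth_proj: "smooth_on {h. \<kappa> h \<noteq> 0} \<pi>"
begin

lemma inj: "inj_on (chart_fun c) (chart_dom c)"
proof (rule inj_onI)
  fix p q assume "p \<in> chart_dom c" "q \<in> chart_dom c" and eq: "chart_fun c p = chart_fun c q"
  then obtain h h' where h: "p = Q h" "h \<in> P" "\<kappa> h \<noteq> 0" and h': "q = Q h'" "h' \<in> P" "\<kappa> h' \<noteq> 0"
    by (auto simp: chart_dom_eq)
  then have "\<pi> h = \<pi> h'"
    using eq chart_fun_eq by simp
  then show "p = q"
    using section_left[OF h(2,3)] section_left[OF h'(2,3)] h h' by simp
qed

lemma image: "chart_fun c ` chart_dom c = {x. \<sigma> x \<in> P}"
proof (intro set_eqI iffI)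
  fix x assume "x \<in> chart_fun c ` chart_dom c"
  then obtain h where "h \<in> P" "\<kappa> h \<noteq> 0" "x = \<pi> h"
    by (auto simp: chart_dom_eq chart_fun_eq)
  then show "x \<in> {x. \<sigma> x \<in> P}"
    using section_left by simp
next
  fix x assume "x \<in> {x. \<sigma> x \<in> P}"
  then have "chart_fun c (Q (\<sigma> x)) = x" "Q (\<sigma> x) \<in> chart_dom c"
    using section_coord[of x] by (auto simp: chart_dom_eq chart_fun_eq section_right)
  then show "x \<in> chart_fun c ` chart_dom c"
    by (metis imageI)
qed

lemma chart_inv_eq:
  assumes "\<sigma> x \<in> P"
  shows "chart_inv c x = Q (\<sigma> x)"
proof -
  have "chart_fun c (Q (\<sigma> x)) = x" "Q (\<sigma> x) \<in> chart_dom c"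
    using assms section_coord[of x] by (auto simp: chart_dom_eq chart_fun_eq section_right)
  then show ?thesis
    using chart_inv_chart_fun[OF inj] by metis
qed

lemma open_section_preimage: "open {x. \<sigma> x \<in> P}"
  using continuous_open_preimage[OF smooth_on_imp_continuous_on[OF smooth_section] _ open_P]
  by (simp add: vimage_def)

lemma open_coord: "open {h. \<kappa> h \<noteq> 0}"
  using continuous_open_preimage[OF continuous_coord, of "- {0}"] by (simp add: vimage_def open_Compl)

end

text \<open>In charts, \<open>f\<close> becomes \<open>\<pi>' \<circ> F \<circ> \<sigma>\<close>:
  the affine section, then the lift, then dehomogenization.\<close>

lemma smooth_in_charts_lift:
  assumes "quotient_chart Q P c \<kappa> \<pi> \<sigma>" and "quotient_chart Q' P' d \<kappa>' \<pi>' \<sigma>'"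
    and F: "smooth_on P F" "\<And>h. h \<in> P \<Longrightarrow> F h \<in> P'" "\<And>h. h \<in> P \<Longrightarrow> f (Q h) = Q' (F h)"
    and p: "p \<in> chart_dom c" "f p \<in> chart_dom d"
  shows "smooth_in_charts c d f p"
proof -
  interpret c: quotient_chart Q P c \<kappa> \<pi> \<sigma> by fact
  interpret d: quotient_chart Q' P' d \<kappa>' \<pi>' \<sigma>' by fact
  have sm: "smooth_on {x. \<sigma> x \<in> P} (\<lambda>x. F (\<sigma> x))"
    by (rule smooth_on_compose[OF c.open_section_preimage c.open_P
          smooth_on_subset[OF subset_UNIV c.smooth_section] _ F(1)]) simp
  define W where "W = {x. \<sigma> x \<in> P} \<inter> (\<lambda>x. F (\<sigma> x)) -` {h. \<kappa>' h \<noteq> 0}"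
  have W: "open W"
    unfolding W_def
    by (intro continuous_open_preimage smooth_on_imp_continuous_on[OF sm] c.open_section_preimage
        d.open_coord)
  obtain h where h: "h \<in> P" "\<kappa> h \<noteq> 0" "p = Q h"
    using p(1) by (auto simp: c.chart_dom_eq)
  have sec: "\<sigma> (\<pi> h) \<in> P" "Q (\<sigma> (\<pi> h)) = Q h"
    using c.section_left[OF h(1,2)] by auto
  obtain h' where h': "h' \<in> P'" "\<kappa>' h' \<noteq> 0" "f p = Q' h'"
    using p(2) by (auto simp: d.chart_dom_eq)
  \<comment> \<open>The lift may represent \<open>f p\<close> by a vector other than
    \<open>h'\<close>; \<open>coord_cong\<close> carries the nonvanishing of the coordinate from one
    representative to the other.\<close>
  have "Q' (F (\<sigma> (\<pi> h))) = Q' h'"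
    using F(3)[OF sec(1)] sec h h' by simp
  then have "\<kappa>' (F (\<sigma> (\<pi> h))) \<noteq> 0"
    using d.coord_cong[OF h'(1) F(2)[OF sec(1)]] h'(2) by simp
  then have "chart_fun c p \<in> W"
    using h sec by (simp add: W_def c.chart_fun_eq)
  moreover have "W \<subseteq> chart_fun c ` chart_dom c"
    by (auto simp: W_def c.image)
  moreover have "f (chart_inv c x) \<in> chart_dom d" if "x \<in> W" for x
    using that F by (auto simp: W_def c.chart_inv_eq d.chart_dom_eq)
  moreover have "smooth_on W (chart_fun d \<circ> f \<circ> chart_inv c)"
  proof (rule smooth_on_cong[OF W])
    show "smooth_on W (\<lambda>x. \<pi>' (F (\<sigma> x)))"
      by (rule smooth_on_compose[OF W d.open_coord smooth_on_subset[OF _ sm] _ d.smooth_proj])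
        (auto simp: W_def)
    show "\<pi>' (F (\<sigma> x)) = (chart_fun d \<circ> f \<circ> chart_inv c) x" if "x \<in> W" for x
      using that F by (simp add: W_def c.chart_inv_eq d.chart_fun_eq)
  qed
  ultimately show ?thesis
    using W p(1) unfolding smooth_in_charts_def by (intro conjI exI[of _ W]) simp_all
qed

section \<open>Projective points and the group action\<close>

lemma rp3_rel_self: "rp3_rel q q \<longleftrightarrow> q \<noteq> 0"
  by (auto simp: rp3_rel_def intro!: exI[of _ 1])

lemma RP3_eq_iff: "q \<noteq> 0 \<Longrightarrow> q' \<noteq> 0 \<Longrightarrow> RP3 q = RP3 q' \<longleftrightarrow> (\<exists>t. t \<noteq> 0 \<and> q' = t *\<^sub>R q)"
  using Quotient_rel[OF Quotient_rp3, of q q'] by (auto simp: rp3_rel_self) (auto simp: rp3_rel_def)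

lemma cp1_rel_self: "cp1_rel v v \<longleftrightarrow> v \<noteq> (0, 0)"
  by (cases v) (auto simp: cp1_rel_def intro!: exI[of _ 1])

lemma CP1_eq_iff:
  assumes "(x, y) \<noteq> (0, 0)" "(x', y') \<noteq> (0, 0)"
  shows "CP1 (x, y) = CP1 (x', y') \<longleftrightarrow> x * y' = x' * y"
proof -
  have "CP1 (x, y) = CP1 (x', y') \<longleftrightarrow> (\<exists>t. t \<noteq> 0 \<and> x' = t * x \<and> y' = t * y)"
    using Quotient_rel[OF Quotient_cp1, of "(x, y)" "(x', y')"] assms
    by (auto simp: cp1_rel_self) (auto simp: cp1_rel_def)
  also have "\<dots> \<longleftrightarrow> x * y' = x' * y"
  proof
    assume eq: "x * y' = x' * y"
    show "\<exists>t. t \<noteq> 0 \<and> x' = t * x \<and> y' = t * y"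
    proof (cases "x = 0")
      case True
      then show ?thesis
        using assms eq by (intro exI[of _ "y' / y"]) auto
    next
      case False
      then show ?thesis
        using assms eq by (intro exI[of _ "x' / x"]) (auto simp: field_simps)
    qed
  qed auto
  finally show ?thesis .
qed

lemma CP1_cases: obtains x y where "P = CP1 (x, y)" "(x, y) \<noteq> (0, 0)"
  using Quotient_rep_reflp[OF Quotient_cp1, of P] Quotient_abs_rep[OF Quotient_cp1, of P]
  by (metis cp1_rel_self surj_pair)

lemma RP3_cases: obtains q where "p = RP3 q" "q \<noteq> 0"
  using Quotient_rep_reflp[OF Quotient_rp3, of p] Quotient_abs_rep[OF Quotient_rp3, of p]
  by (metis rp3_rel_self)

lemma sl2_rel_self: "sl2_rel S S \<longleftrightarrow> det S = 1"
  by (simp add: sl2_rel_def)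

lemma psl2r_cases: obtains S where "T = abs_psl2r S" "det S = 1"
  using Quotient_rep_reflp[OF Quotient_psl2r, of T] Quotient_abs_rep[OF Quotient_psl2r, of T]
  by (metis sl2_rel_self)

lemma abs_psl2r_uminus: "det S = 1 \<Longrightarrow> abs_psl2r (- S) = abs_psl2r S"
  using Quotient_rel_abs[OF Quotient_psl2r, of S "- S"] by (simp add: sl2_rel_def)

lemma matrix_inv_det_1:
  fixes S :: "real^2^2"
  assumes "det S = 1"
  shows "S ** matrix_inv S = mat 1" "matrix_inv S ** S = mat 1" "det (matrix_inv S) = 1"
proof -
  have "invertible S"
    using assms by (simp add: invertible_det_nz)
  from matrix_inv_inverse[OF this]
  show "S ** matrix_inv S = mat 1" "matrix_inv S ** S = mat 1" by auto
  then show "det (matrix_inv S) = 1"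
    using assms det_mul[of S "matrix_inv S"] by simp
qed

lemma moebius_CP1:
  assumes "det S = 1" "(x, y) \<noteq> (0, 0)"
  shows "moebius (abs_psl2r S) (CP1 (x, y)) =
    CP1 (of_real (S$1$1) * x + of_real (S$1$2) * y, of_real (S$2$1) * x + of_real (S$2$2) * y)"
  using assms by (simp add: moebius.abs_eq sl2_rel_self cp1_rel_self)

text \<open>The generic field lets this serve both complex homogeneous coordinates and the real
  coordinates \<open>(x, y)\<close> of a real root.\<close>

lemma sl2_apply_nonzero:
  fixes S :: "real^2^2" and x y :: "'a::real_field"
  assumes "det S = 1" "(x, y) \<noteq> (0, 0)"
  shows "(of_real (S$1$1) * x + of_real (S$1$2) * y, of_real (S$2$1) * x + of_real (S$2$2) * y) \<noteq> (0, 0)"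
proof
  define k l m n :: 'a where "k = of_real (S$1$1)" "l = of_real (S$1$2)"
    "m = of_real (S$2$1)" "n = of_real (S$2$2)"
  have det: "k * n - l * m = 1"
    using assms(1) by (simp add: k_l_m_n_def det_2 flip: of_real_mult of_real_diff)
  assume "(of_real (S$1$1) * x + of_real (S$1$2) * y, of_real (S$2$1) * x + of_real (S$2$2) * y) = (0, 0)"
  then have "k * x + l * y = 0" "m * x + n * y = 0"
    by (simp_all add: k_l_m_n_def)
  with det have "x = 0" "y = 0"
    by algebra+
  with assms(2) show False by simp
qed

lemma moebius_moebius:
  assumes "det S = 1" "det S' = 1"
  shows "moebius (abs_psl2r S) (moebius (abs_psl2r S') P) = moebius (abs_psl2r (S ** S')) P"
proof -
  obtain x y where P: "P = CP1 (x, y)" "(x, y) \<noteq> (0, 0)"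
    by (rule CP1_cases)
  have "det (S ** S') = 1"
    using assms by (simp add: det_mul)
  then show ?thesis
    using assms P sl2_apply_nonzero[OF assms(2) P(2)]
    by (simp add: moebius_CP1 matrix_matrix_mult_def sum_2 algebra_simps)
qed

lemma moebius_mat_1: "moebius (abs_psl2r (mat 1)) P = P"
proof -
  obtain x y where P: "P = CP1 (x, y)" "(x, y) \<noteq> (0, 0)"
    by (rule CP1_cases)
  have "det (mat 1 :: real^2^2) = 1" by simp
  from moebius_CP1[OF this P(2)] show ?thesis
    by (simp add: P(1) mat_def)
qed

lemma is_root_RP3:
  "q \<noteq> 0 \<Longrightarrow> (x, y) \<noteq> (0, 0) \<Longrightarrow> is_root (RP3 q) (CP1 (x, y)) \<longleftrightarrow> binary_cubic q x y = 0"
  by (simp add: is_root.abs_eq rp3_rel_self cp1_rel_self)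

lemma coefs_act_RP3:
  "det S = 1 \<Longrightarrow> q \<noteq> 0 \<Longrightarrow> coefs_act (abs_psl2r S) (RP3 q) = RP3 (cubic_subst (matrix_inv S) q)"
  by (simp add: coefs_act.abs_eq rp3_rel_self sl2_rel_self)

lemma cubic_subst_inv_nonzero:
  "det S = 1 \<Longrightarrow> q \<noteq> 0 \<Longrightarrow> cubic_subst (matrix_inv S) q \<noteq> 0"
  using cubic_subst_nonzero[of "matrix_inv S" q] matrix_inv_det_1(3)[of S]
  by (simp add: invertible_det_nz)

text \<open>The transformed cubic vanishes at \<open>P\<close> exactly when the original one
  vanishes at the image of \<open>P\<close> under the inverse matrix, so the roots move by the
  matrix itself.\<close>

lemma roots_map_coefs_act: "roots_map (coefs_act T p) = roots_act T (roots_map p)"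
proof -
  obtain S where S: "T = abs_psl2r S" "det S = 1"
    by (rule psl2r_cases)
  obtain q where q: "p = RP3 q" "q \<noteq> 0"
    by (rule RP3_cases)
  let ?S' = "matrix_inv S"
  note inv = matrix_inv_det_1[OF S(2)]
  have root: "is_root (coefs_act T p) P \<longleftrightarrow> is_root p (moebius (abs_psl2r ?S') P)" for P
  proof -
    obtain x y where P: "P = CP1 (x, y)" "(x, y) \<noteq> (0, 0)"
      by (rule CP1_cases)
    show ?thesis
      using S q P sl2_apply_nonzero[OF inv(3) P(2)] cubic_subst_inv_nonzero[OF S(2) q(2)]
      by (simp add: coefs_act_RP3 is_root_RP3 moebius_CP1 inv(3) binary_cubic_subst)
  qed
  have "moebius T (moebius (abs_psl2r ?S') P) = P" "moebius (abs_psl2r ?S') (moebius T P) = P" for P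
    using S inv by (simp_all add: moebius_moebius moebius_mat_1)
  then show ?thesis
    unfolding roots_map_def roots_act_def by (auto simp: root image_iff) metis
qed

lemma psl2r_act_inverse:
  "\<exists>T'. (\<forall>p. coefs_act T' (coefs_act T p) = p) \<and> (\<forall>s. roots_act T' (roots_act T s) = s)"
proof -
  obtain S where S: "T = abs_psl2r S" "det S = 1"
    by (rule psl2r_cases)
  note inv = matrix_inv_det_1[OF S(2)]
  let ?T' = "abs_psl2r (matrix_inv S)"
  have "coefs_act ?T' (coefs_act T p) = p" for p
  proof -
    obtain q where q: "p = RP3 q" "q \<noteq> 0"
      by (rule RP3_cases)
    then show ?thesis
      using S inv cubic_subst_inv_nonzero[OF S(2) q(2)] matrix_inv_det_1(1)[OF inv(3)]
      by (simp add: coefs_act_RP3 cubic_subst_cubic_subst cubic_subst_mat_1)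
  qed
  moreover have "roots_act ?T' (roots_act T s) = s" for s
    using S inv by (simp add: roots_act_def image_image moebius_moebius moebius_mat_1)
  ultimately show ?thesis by blast
qed

section \<open>The charts of the two manifolds\<close>

definition disc :: "coefs \<Rightarrow> real" where
  "disc = (\<lambda>(a, b, c, d). cubic_disc a b c d)"

text \<open>The degree is even, so the sign of the discriminant is well defined on projective
  classes.\<close>

lemma disc_scaleR: "disc (t *\<^sub>R q) = t ^ 4 * disc q"
  by (cases q) (simp add: disc_def cubic_disc_def algebra_simps power_mult_distrib power2_eq_square
      power3_eq_cube power4_eq_xxxx)

text \<open>The discriminant is an invariant of weight 6; for determinant 1 it is unchanged, which
  keeps the coefficient space stable under the action.\<close>

lemma disc_cubic_subst: "disc (cubic_subst S q) = det S ^ 6 * disc q"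
proof (cases q)
  case (fields a b c d)
  define k l m n where klmn: "k = S$1$1" "l = S$1$2" "m = S$2$1" "n = S$2$2"
  show ?thesis
    unfolding fields cubic_subst_def disc_def det_2 Let_def prod.case cubic_disc_def
      klmn[symmetric] by algebra
qed

lemma disc_neg_nonzero: "disc q < 0 \<Longrightarrow> q \<noteq> 0"
  by (auto simp: disc_def cubic_disc_def zero_prod_def)

lemma continuous_disc: "continuous_on UNIV disc"
  unfolding disc_def cubic_disc_def case_prod_beta by (intro continuous_intros)

lemma open_disc_neg: "open {q. disc q < 0}"
  using open_Collect_less[OF continuous_disc continuous_on_const] by simp

lemma UTH2_Coefs_eq: "UTH2_Coefs = RP3 ` {q. disc q < 0}"
  by (auto simp: UTH2_Coefs_def disc_def image_iff)

text \<open>One argument for all four affine charts: \<open>\<kappa>\<close> is the coordinate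
  normalized to 1, and dividing by it changes \<open>disc\<close> by a positive factor.\<close>

lemma quotient_chart_coefs:
  assumes dom: "chart_dom c = RP3 ` {q. disc q < 0 \<and> \<kappa> q \<noteq> 0}"
    and "\<And>q. q \<noteq> 0 \<Longrightarrow> chart_fun c (RP3 q) = \<pi> q"
    and \<kappa>: "bounded_linear \<kappa>"
    and "\<And>x. \<kappa> (\<sigma> x) = 1" "\<And>x. \<pi> (\<sigma> x) = x"
    and sec: "\<And>q. \<kappa> q \<noteq> 0 \<Longrightarrow> \<kappa> q *\<^sub>R \<sigma> (\<pi> q) = q"
    and "smooth_on UNIV \<sigma>" "smooth_on {q. \<kappa> q \<noteq> 0} \<pi>"
  shows "quotient_chart RP3 {q. disc q < 0} c \<kappa> \<pi> \<sigma>"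
proof
  show "\<sigma> (\<pi> h) \<in> {q. disc q < 0} \<and> RP3 (\<sigma> (\<pi> h)) = RP3 h"
    if "h \<in> {q. disc q < 0}" "\<kappa> h \<noteq> 0" for h
  proof -
    have nz: "h \<noteq> 0" "\<sigma> (\<pi> h) \<noteq> 0"
      using that(1) disc_neg_nonzero[of h] sec[OF that(2)] scaleR_zero_right[of "\<kappa> h"] by auto
    have "\<kappa> h ^ 4 * disc (\<sigma> (\<pi> h)) < 0"
      using that sec[OF that(2)] by (simp flip: disc_scaleR)
    then have "disc (\<sigma> (\<pi> h)) < 0"
      using that(2) by (simp add: mult_less_0_iff)
    moreover have "RP3 (\<sigma> (\<pi> h)) = RP3 h"
      using nz sec[OF that(2)] that(2) by (subst RP3_eq_iff) metis+
    ultimately show ?thesis by simp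
  qed
  show "\<kappa> h' \<noteq> 0" if "h \<in> {q. disc q < 0}" "h' \<in> {q. disc q < 0}" "RP3 h = RP3 h'" "\<kappa> h \<noteq> 0" for h h'
    using that linear_cmul[OF bounded_linear.linear[OF \<kappa>], of _ h]
    by (auto simp: disc_neg_nonzero RP3_eq_iff)
qed (use assms in \<open>auto simp: open_disc_neg disc_neg_nonzero linear_continuous_on\<close>)

lemma quotient_chart_monic:
  "quotient_chart RP3 {q. disc q < 0} monic_chart fst
    (\<lambda>(a, b, c, d). (b / a, c / a, d / a)) (\<lambda>(u, v, w). (1, u, v, w))"
proof (rule quotient_chart_coefs)
  have "open {q :: coefs. fst q \<noteq> 0}"
    by (intro open_Collect_neq continuous_intros)
  then show "smooth_on {q :: coefs. fst q \<noteq> 0} (\<lambda>(a, b, c, d). (b / a, c / a, d / a))"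
    unfolding case_prod_beta by (intro smooth_on_intros) simp_all
  show "smooth_on UNIV (\<lambda>(u :: real, v :: real, w :: real). (1 :: real, u, v, w))"
    unfolding case_prod_beta by (intro smooth_on_intros) simp_all
qed (auto simp: monic_chart_def disc_def image_iff aff_a.abs_eq rp3_rel_self bounded_linear_fst, blast)

lemma quotient_chart_coefs_atlas:
  assumes "c \<in> coefs_atlas"
  shows "\<exists>\<kappa> \<pi> \<sigma>. quotient_chart RP3 {q. disc q < 0} c \<kappa> \<pi> \<sigma>"
proof -
  have b: "quotient_chart RP3 {q. disc q < 0}
      ({RP3 (a, b, c, d) | a b c d. cubic_disc a b c d < 0 \<and> b \<noteq> 0}, aff_b)
      (\<lambda>q. fst (snd q)) (\<lambda>(a, b, c, d). (a / b, c / b, d / b)) (\<lambda>(u, v, w). (u, 1, v, w))"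
  proof (rule quotient_chart_coefs)
    have "open {q :: coefs. fst (snd q) \<noteq> 0}"
      by (intro open_Collect_neq continuous_intros)
    then show "smooth_on {q :: coefs. fst (snd q) \<noteq> 0} (\<lambda>(a, b, c, d). (a / b, c / b, d / b))"
      unfolding case_prod_beta by (intro smooth_on_intros) simp_all
    show "smooth_on UNIV (\<lambda>(u :: real, v :: real, w :: real). (u, 1 :: real, v, w))"
      unfolding case_prod_beta by (intro smooth_on_intros) simp_all
    show "bounded_linear (\<lambda>q :: coefs. fst (snd q))"
      by (intro bounded_linear_intros)
  qed (auto simp: disc_def image_iff aff_b.abs_eq rp3_rel_self, blast)
  have c: "quotient_chart RP3 {q. disc q < 0}
      ({RP3 (a, b, c, d) | a b c d. cubic_disc a b c d < 0 \<and> c \<noteq> 0}, aff_c)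
      (\<lambda>q. fst (snd (snd q))) (\<lambda>(a, b, c, d). (a / c, b / c, d / c)) (\<lambda>(u, v, w). (u, v, 1, w))"
  proof (rule quotient_chart_coefs)
    have "open {q :: coefs. fst (snd (snd q)) \<noteq> 0}"
      by (intro open_Collect_neq continuous_intros)
    then show "smooth_on {q :: coefs. fst (snd (snd q)) \<noteq> 0} (\<lambda>(a, b, c, d). (a / c, b / c, d / c))"
      unfolding case_prod_beta by (intro smooth_on_intros) simp_all
    show "smooth_on UNIV (\<lambda>(u :: real, v :: real, w :: real). (u, v, 1 :: real, w))"
      unfolding case_prod_beta by (intro smooth_on_intros) simp_all
    show "bounded_linear (\<lambda>q :: coefs. fst (snd (snd q)))"
      by (intro bounded_linear_intros)
  qed (auto simp: disc_def image_iff aff_c.abs_eq rp3_rel_self, blast)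
  have d: "quotient_chart RP3 {q. disc q < 0}
      ({RP3 (a, b, c, d) | a b c d. cubic_disc a b c d < 0 \<and> d \<noteq> 0}, aff_d)
      (\<lambda>q. snd (snd (snd q))) (\<lambda>(a, b, c, d). (a / d, b / d, c / d)) (\<lambda>(u, v, w). (u, v, w, 1))"
  proof (rule quotient_chart_coefs)
    have "open {q :: coefs. snd (snd (snd q)) \<noteq> 0}"
      by (intro open_Collect_neq continuous_intros)
    then show "smooth_on {q :: coefs. snd (snd (snd q)) \<noteq> 0} (\<lambda>(a, b, c, d). (a / d, b / d, c / d))"
      unfolding case_prod_beta by (intro smooth_on_intros) simp_all
    show "smooth_on UNIV (\<lambda>(u :: real, v :: real, w :: real). (u, v, w, 1 :: real))"
      unfolding case_prod_beta by (intro smooth_on_intros) simp_all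
    show "bounded_linear (\<lambda>q :: coefs. snd (snd (snd q)))"
      by (intro bounded_linear_intros)
  qed (auto simp: disc_def image_iff aff_d.abs_eq rp3_rel_self, blast)
  show ?thesis
    using assms quotient_chart_monic b c d unfolding coefs_atlas_def by blast
qed

lemma smooth_on_cubic_subst: "open P \<Longrightarrow> smooth_on P (cubic_subst S)"
  unfolding cubic_subst_def Let_def case_prod_beta by (intro smooth_on_intros)

section \<open>Root side: homogeneous coordinates for the real root\<close>

type_synonym root_coords = "(real \<times> real) \<times> complex"

text \<open>Taking the member of the conjugate pair in the upper half plane leaves the scaling of
  the real pair as the only ambiguity. Root sets thus form a quotient of an open set, as
  \<open>quotient_chart\<close> demands.\<close>

definition root_data :: "root_coords set" where
  "root_data = {h. fst h \<noteq> (0, 0) \<and> 0 < Im (snd h)}"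

definition rootset :: "root_coords \<Rightarrow> cp1 set" where
  "rootset = (\<lambda>((x, y), z). {CP1 (of_real x, of_real y), cp1_of z, cp1_of (cnj z)})"

lemma mem_root_data: "((x, y), z) \<in> root_data \<longleftrightarrow> (x, y) \<noteq> (0, 0) \<and> 0 < Im z"
  by (simp add: root_data_def)

lemma open_root_data: "open root_data"
  unfolding root_data_def
  by (intro open_Collect_conj open_Collect_neq open_Collect_less continuous_intros)

lemma cp1_of_eq_iff: "cp1_of z = cp1_of w \<longleftrightarrow> z = w"
  by (simp add: cp1_of_def CP1_eq_iff)

lemma cp1_of_eq_CP1_real:
  assumes "(x, y) \<noteq> (0, 0)" "cp1_of z = CP1 (of_real x, of_real y)"
  shows "Im z = 0"
proof -
  have "z * of_real y = of_real x"
    using assms by (simp add: cp1_of_def CP1_eq_iff)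
  then have "Im z * y = 0" "Re z * y = x"
    by (auto simp: complex_eq_iff)
  then show ?thesis
    using assms(1) by auto
qed

lemma cp1_of_in_RP1: "cp1_of z \<in> RP1 \<Longrightarrow> Im z = 0"
  using cp1_of_eq_CP1_real by (auto simp: RP1_def)

lemma real_root_rootset:
  assumes "((x, y), z) \<in> root_data"
  shows "real_root (rootset ((x, y), z)) = CP1 (of_real x, of_real y)"
  unfolding real_root_def
proof (rule the_equality)
  show "CP1 (of_real x, of_real y) \<in> rootset ((x, y), z) \<and> CP1 (of_real x, of_real y) \<in> RP1"
    using assms by (auto simp: rootset_def RP1_def mem_root_data)
  show "r = CP1 (of_real x, of_real y)" if "r \<in> rootset ((x, y), z) \<and> r \<in> RP1" for r
    using that assms cp1_of_in_RP1[of z] cp1_of_in_RP1[of "cnj z"]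
    by (auto simp: rootset_def mem_root_data)
qed

lemma upper_root_rootset:
  assumes "((x, y), z) \<in> root_data"
  shows "upper_root (rootset ((x, y), z)) = z"
  unfolding upper_root_def
proof (rule the_equality)
  show "cp1_of z \<in> rootset ((x, y), z) \<and> 0 < Im z"
    using assms by (auto simp: rootset_def mem_root_data)
  show "w = z" if "cp1_of w \<in> rootset ((x, y), z) \<and> 0 < Im w" for w
    using that assms cp1_of_eq_CP1_real[of x y w]
    by (auto simp: rootset_def mem_root_data cp1_of_eq_iff)
qed

lemma rootset_eqD:
  assumes "((x, y), z) \<in> root_data" "((x', y'), z') \<in> root_data"
    and "rootset ((x, y), z) = rootset ((x', y'), z')"
  shows "z = z'" "x * y' = x' * y"
proof -
  show "z = z'"
    using upper_root_rootset assms by metis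
  have "CP1 (complex_of_real x, complex_of_real y) = CP1 (of_real x', of_real y')"
    using real_root_rootset assms by metis
  then have "complex_of_real x * of_real y' = of_real x' * of_real y"
    using assms by (subst (asm) CP1_eq_iff) (auto simp: mem_root_data)
  then show "x * y' = x' * y"
    by (simp flip: of_real_mult)
qed

lemma UTH2_Roots_eq: "UTH2_Roots = rootset ` root_data"
proof (intro set_eqI iffI)
  fix s assume "s \<in> UTH2_Roots"
  then obtain x y z where s: "s = {CP1 (of_real x, of_real y), cp1_of z, cp1_of (cnj z)}"
    "(x, y) \<noteq> (0, 0)" "z \<notin> \<real>"
    by (auto simp: UTH2_Roots_def RP1_def)
  have "Im z \<noteq> 0"
    using s(3) complex_is_Real_iff by blast
  then consider "0 < Im z" | "0 < Im (cnj z)"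
    by fastforce
  then show "s \<in> rootset ` root_data"
  proof cases
    case 1
    then show ?thesis
      using s by (intro image_eqI[of _ _ "((x, y), z)"]) (auto simp: rootset_def mem_root_data)
  next
    case 2
    then show ?thesis
      using s by (intro image_eqI[of _ _ "((x, y), cnj z)"]) (auto simp: rootset_def mem_root_data)
  qed
next
  fix s assume "s \<in> rootset ` root_data"
  then obtain x y z where "s = rootset ((x, y), z)" "(x, y) \<noteq> (0, 0)" "Im z > 0"
    by (auto simp: mem_root_data)
  then show "s \<in> UTH2_Roots"
    unfolding UTH2_Roots_def rootset_def RP1_def using complex_is_Real_iff[of z] by auto
qed

lemma CP1_real_eq_cp1_inf:
  "(x, y) \<noteq> (0, 0) \<Longrightarrow> CP1 (complex_of_real x, of_real y) = cp1_inf \<longleftrightarrow> y = 0"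
  by (subst cp1_inf_def, subst CP1_eq_iff) auto

lemma CP1_real_eq_cp1_of_0:
  "(x, y) \<noteq> (0, 0) \<Longrightarrow> CP1 (complex_of_real x, of_real y) = cp1_of 0 \<longleftrightarrow> x = 0"
  by (subst cp1_of_def, subst CP1_eq_iff) auto

lemma aff_CP1_real:
  assumes "(x, y) \<noteq> (0, 0)"
  shows "aff_x (CP1 (of_real x, of_real y)) = of_real (x / y)"
    "aff_y (CP1 (of_real x, of_real y)) = of_real (y / x)"
  using assms by (simp_all add: aff_x.abs_eq aff_y.abs_eq cp1_rel_self)

lemma rootset_eqI:
  assumes "((x, y), z) \<in> root_data" "((x', y'), z) \<in> root_data" "x * y' = x' * y"
  shows "rootset ((x, y), z) = rootset ((x', y'), z)"
proof -
  have "CP1 (complex_of_real x, complex_of_real y) = CP1 (of_real x', of_real y')"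
    using assms by (subst CP1_eq_iff) (auto simp: mem_root_data simp flip: of_real_mult)
  then show ?thesis
    by (simp add: rootset_def)
qed

lemma quotient_chart_finite:
  "quotient_chart rootset root_data finite_chart (\<lambda>h. snd (fst h))
    (\<lambda>((x, y), z). (x / y, z)) (\<lambda>(t, z). ((t, 1), z))"
proof
  show "chart_dom finite_chart = rootset ` {h \<in> root_data. snd (fst h) \<noteq> 0}"
    by (auto simp: finite_chart_def UTH2_Roots_eq real_root_rootset CP1_real_eq_cp1_inf mem_root_data)
  show "chart_fun finite_chart (rootset h) = (\<lambda>((x, y), z). (x / y, z)) h"
    if "h \<in> root_data" "snd (fst h) \<noteq> 0" for h
    using that by (auto split: prod.splits simp: finite_chart_def real_root_rootset upper_root_rootset aff_CP1_real mem_root_data)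
  have "open {h :: root_coords. snd (fst h) \<noteq> 0}"
    by (intro open_Collect_neq continuous_intros)
  then show "smooth_on {h :: root_coords. snd (fst h) \<noteq> 0} (\<lambda>((x, y), z). (x / y, z))"
    unfolding case_prod_beta by (intro smooth_on_intros) simp_all
  show "smooth_on UNIV (\<lambda>(t :: real, z :: complex). ((t, 1 :: real), z))"
    unfolding case_prod_beta by (intro smooth_on_intros) simp_all
  show "continuous_on UNIV (\<lambda>h :: root_coords. snd (fst h))"
    by (intro continuous_intros)
  show "snd (fst h') \<noteq> 0" if "h \<in> root_data" "h' \<in> root_data" "rootset h = rootset h'" "snd (fst h) \<noteq> 0" for h h'
    using that rootset_eqD(2)[of "fst (fst h)" "snd (fst h)" "snd h" "fst (fst h')" "snd (fst h')" "snd h'"]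
    by (auto simp: root_data_def prod_eq_iff)
  show "(\<lambda>(t, z). ((t, 1), z)) ((\<lambda>((x, y), z). (x / y, z)) h) \<in> root_data \<and>
      rootset ((\<lambda>(t, z). ((t, 1), z)) ((\<lambda>((x, y), z). (x / y, z)) h)) = rootset h"
    if "h \<in> root_data" "snd (fst h) \<noteq> 0" for h
  proof -
    obtain x y z where h: "h = ((x, y), z)"
      by (metis surj_pair)
    have "rootset ((x / y, 1), z) = rootset ((x, y), z)"
      using that by (intro rootset_eqI) (simp_all add: h mem_root_data)
    then show ?thesis
      using that by (simp add: h mem_root_data)
  qed
qed (auto simp: open_root_data)

lemma quotient_chart_infinite:
  "quotient_chart rootset root_data infinite_chart (\<lambda>h. fst (fst h))
    (\<lambda>((x, y), z). (y / x, z)) (\<lambda>(t, z). ((1, t), z))"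
proof
  show "chart_dom infinite_chart = rootset ` {h \<in> root_data. fst (fst h) \<noteq> 0}"
    by (auto simp: infinite_chart_def UTH2_Roots_eq real_root_rootset CP1_real_eq_cp1_of_0 mem_root_data)
  show "chart_fun infinite_chart (rootset h) = (\<lambda>((x, y), z). (y / x, z)) h"
    if "h \<in> root_data" "fst (fst h) \<noteq> 0" for h
    using that by (auto split: prod.splits simp: infinite_chart_def real_root_rootset upper_root_rootset aff_CP1_real mem_root_data)
  have "open {h :: root_coords. fst (fst h) \<noteq> 0}"
    by (intro open_Collect_neq continuous_intros)
  then show "smooth_on {h :: root_coords. fst (fst h) \<noteq> 0} (\<lambda>((x, y), z). (y / x, z))"
    unfolding case_prod_beta by (intro smooth_on_intros) simp_all
  show "smooth_on UNIV (\<lambda>(t :: real, z :: complex). ((1 :: real, t), z))"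
    unfolding case_prod_beta by (intro smooth_on_intros) simp_all
  show "continuous_on UNIV (\<lambda>h :: root_coords. fst (fst h))"
    by (intro continuous_intros)
  show "fst (fst h') \<noteq> 0" if "h \<in> root_data" "h' \<in> root_data" "rootset h = rootset h'" "fst (fst h) \<noteq> 0" for h h'
    using that rootset_eqD(2)[of "fst (fst h)" "snd (fst h)" "snd h" "fst (fst h')" "snd (fst h')" "snd h'"]
    by (auto simp: root_data_def prod_eq_iff)
  show "(\<lambda>(t, z). ((1, t), z)) ((\<lambda>((x, y), z). (y / x, z)) h) \<in> root_data \<and>
      rootset ((\<lambda>(t, z). ((1, t), z)) ((\<lambda>((x, y), z). (y / x, z)) h)) = rootset h"
    if "h \<in> root_data" "fst (fst h) \<noteq> 0" for h
  proof -
    obtain x y z where h: "h = ((x, y), z)"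
      by (metis surj_pair)
    have "rootset ((1, y / x), z) = rootset ((x, y), z)"
      using that by (intro rootset_eqI) (simp_all add: h mem_root_data)
    then show ?thesis
      using that by (simp add: h mem_root_data)
  qed
qed (auto simp: open_root_data)

lemma quotient_chart_roots_atlas:
  "d \<in> roots_atlas \<Longrightarrow> \<exists>\<kappa> \<pi> \<sigma>. quotient_chart rootset root_data d \<kappa> \<pi> \<sigma>"
  using quotient_chart_finite quotient_chart_infinite unfolding roots_atlas_def by blast

section \<open>Actions and the roots map in homogeneous coordinates\<close>

text \<open>The second component is \<open>(k * z + l) / (m * z + n)\<close> made real in the
  denominator \<open>D\<close>, the squared modulus of \<open>m * z + n\<close>; determinant 1
  reduces the imaginary part to \<open>Im z / D\<close>. Real and imaginary parts are separate
  because the quotient rule for \<open>smooth_on\<close> concerns real functions.\<close>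

definition act_root_data :: "real^2^2 \<Rightarrow> root_coords \<Rightarrow> root_coords" where
  "act_root_data S = (\<lambda>((x, y), z).
     let k = S$1$1; l = S$1$2; m = S$2$1; n = S$2$2; D = (m * Re z + n)\<^sup>2 + (m * Im z)\<^sup>2 in
     ((k * x + l * y, m * x + n * y),
      Complex (((k * Re z + l) * (m * Re z + n) + k * m * (Im z)\<^sup>2) / D) (Im z / D)))"

lemma act_root_data_denominator:
  fixes S :: "real^2^2"
  assumes "det S = 1" "Im z \<noteq> 0"
  shows "(S$2$1 * Re z + S$2$2)\<^sup>2 + (S$2$1 * Im z)\<^sup>2 > 0"
proof (cases "S$2$1 = 0")
  case True
  then show ?thesis using assms by (auto simp: det_2)
next
  case False
  then have "(S$2$1 * Im z)\<^sup>2 > 0"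
    using assms by simp
  then show ?thesis
    by (simp add: add_nonneg_pos)
qed

lemma act_root_data_closed:
  assumes "det S = 1" "h \<in> root_data"
  shows "act_root_data S h \<in> root_data"
proof -
  obtain x y z where h: "h = ((x, y), z)"
    by (metis surj_pair)
  then show ?thesis
    using assms act_root_data_denominator[of S z] sl2_apply_nonzero[of S x y]
    by (auto simp: act_root_data_def Let_def mem_root_data)
qed

lemma smooth_act_root_data:
  assumes "det S = 1"
  shows "smooth_on root_data (act_root_data S)"
proof -
  have "(S$2$1 * Re (snd h) + S$2$2)\<^sup>2 + (S$2$1 * Im (snd h))\<^sup>2 \<noteq> 0" if "h \<in> root_data" for h
    using act_root_data_denominator[OF assms, of "snd h"] that by (auto simp: root_data_def)
  then show ?thesis
    unfolding act_root_data_def Let_def case_prod_beta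
    by (intro smooth_on_intros open_root_data) auto
qed

text \<open>Assuming \<open>Im z \<noteq> 0\<close> rather than positivity makes this apply to
  \<open>cnj z\<close> as well, which then yields the conjugate image.\<close>

lemma moebius_cp1_of:
  assumes S: "det S = 1" and z: "Im z \<noteq> 0"
  defines "D \<equiv> (S$2$1 * Re z + S$2$2)\<^sup>2 + (S$2$1 * Im z)\<^sup>2"
  shows "moebius (abs_psl2r S) (cp1_of z) =
    cp1_of (Complex (((S$1$1 * Re z + S$1$2) * (S$2$1 * Re z + S$2$2) + S$1$1 * S$2$1 * (Im z)\<^sup>2) / D) (Im z / D))"
proof -
  define k l m n where klmn: "k = S$1$1" "l = S$1$2" "m = S$2$1" "n = S$2$2"
  have det: "k * n - l * m = 1"
    using S by (simp add: klmn det_2)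
  have D: "D > 0"
    using act_root_data_denominator[OF S z] by (simp add: D_def)
  define w where "w = Complex (((k * Re z + l) * (m * Re z + n) + k * m * (Im z)\<^sup>2) / D) (Im z / D)"
  have nz: "(of_real k * z + of_real l, of_real m * z + of_real n) \<noteq> (0, 0)"
    using sl2_apply_nonzero[OF S, of z 1] by (simp add: klmn)
  define N where "N = (k * Re z + l) * (m * Re z + n) + k * m * (Im z)\<^sup>2"
  \<comment> \<open>Real and imaginary parts of \<open>k * z + l = w * (m * z + n)\<close>, cleared
    of the denominator \<open>D\<close>.\<close>
  have "(k * Re z + l) * D = N * (m * Re z + n) - Im z * (m * Im z)"
    "k * Im z * D = N * (m * Im z) + Im z * (m * Re z + n)"
    unfolding D_def N_def klmn[symmetric] using det by algebra+
  then have "k * Re z + l = (N * (m * Re z + n) - Im z * (m * Im z)) / D"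
    "k * Im z = (N * (m * Im z) + Im z * (m * Re z + n)) / D"
    using D by (simp_all add: eq_divide_eq)
  then have re: "k * Re z + l = N / D * (m * Re z + n) - Im z / D * (m * Im z)"
    and im: "k * Im z = N / D * (m * Im z) + Im z / D * (m * Re z + n)"
    by (simp_all add: diff_divide_distrib add_divide_distrib)
  have w: "w = Complex (N / D) (Im z / D)"
    by (simp add: w_def N_def)
  have "of_real k * z + of_real l = w * (of_real m * z + of_real n)"
    using re im by (simp add: complex_eq_iff w)
  then have "CP1 (of_real k * z + of_real l, of_real m * z + of_real n) = CP1 (w, 1)"
    using nz by (subst CP1_eq_iff) auto
  then show ?thesis
    using S by (simp add: cp1_of_def moebius_CP1 w_def klmn)
qed

lemma roots_act_rootset:
  assumes S: "det S = 1" and h: "h \<in> root_data"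
  shows "roots_act (abs_psl2r S) (rootset h) = rootset (act_root_data S h)"
proof -
  obtain x y z where h': "h = ((x, y), z)" "(x, y) \<noteq> (0, 0)" "Im z > 0"
    using h by (metis mem_root_data surj_pair)
  have "moebius (abs_psl2r S) (CP1 (of_real x, of_real y)) =
      CP1 (of_real (S$1$1 * x + S$1$2 * y), of_real (S$2$1 * x + S$2$2 * y))"
    using S h'(2) by (simp add: moebius_CP1)
  then show ?thesis
    using moebius_cp1_of[OF S, of z] moebius_cp1_of[OF S, of "cnj z"] h'(3)
    by (simp add: h'(1) roots_act_def rootset_def act_root_data_def Let_def complex_cnj)
qed

text \<open>The expansion of \<open>(y X - x Y) (X - z Y) (X - cnj z Y)\<close>, a polynomial lift
  of the inverse of the roots map.\<close>

definition cubic_of :: "root_coords \<Rightarrow> coefs" where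
  "cubic_of = (\<lambda>((x, y), z). let p = Re z; m = (Re z)\<^sup>2 + (Im z)\<^sup>2 in
     (y, - 2 * p * y - x, m * y + 2 * p * x, - m * x))"

lemma smooth_cubic_of: "open P \<Longrightarrow> smooth_on P cubic_of"
  unfolding cubic_of_def Let_def case_prod_beta by (intro smooth_on_intros)

lemma binary_cubic_cubic_of:
  "binary_cubic (cubic_of ((x, y), z)) X Y =
    (of_real y * X - of_real x * Y) * (X - z * Y) * (X - cnj z * Y)"
proof -
  have "of_real (2 * Re z) = z + cnj z" "of_real ((Re z)\<^sup>2 + (Im z)\<^sup>2) = z * cnj z"
    by (simp_all add: complex_add_cnj complex_mult_cnj)
  moreover have "binary_cubic (cubic_of ((x, y), z)) X Y =
      of_real y * X ^ 3 + (- of_real (2 * Re z) * of_real y - of_real x) * X\<^sup>2 * Y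
      + (of_real ((Re z)\<^sup>2 + (Im z)\<^sup>2) * of_real y + of_real (2 * Re z) * of_real x) * X * Y\<^sup>2
      + (- of_real ((Re z)\<^sup>2 + (Im z)\<^sup>2) * of_real x) * Y ^ 3"
    by (simp add: cubic_of_def Let_def algebra_simps)
  ultimately show ?thesis
    by (simp only:) (simp add: algebra_simps power2_eq_square power3_eq_cube)
qed

text \<open>The product of the squared root differences: the conjugate pair contributes
  \<open>- 4 * (Im z)\<^sup>2\<close>, and each of its members contributes its squared difference to
  the real root, which together give the fourth power of the modulus of
  \<open>x - y z\<close>.\<close>

lemma disc_cubic_of:
  "disc (cubic_of ((x, y), z)) = - 4 * (Im z)\<^sup>2 * ((x - y * Re z)\<^sup>2 + y\<^sup>2 * (Im z)\<^sup>2)\<^sup>2"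
  unfolding disc_def cubic_of_def cubic_disc_def Let_def prod.case by algebra

lemma disc_cubic_of_neg:
  assumes "h \<in> root_data"
  shows "disc (cubic_of h) < 0"
proof -
  obtain x y z where h: "h = ((x, y), z)" "(x, y) \<noteq> (0, 0)" "Im z > 0"
    using assms by (metis mem_root_data surj_pair)
  then have "(x - y * Re z)\<^sup>2 + y\<^sup>2 * (Im z)\<^sup>2 \<noteq> 0"
    by (auto simp: add_nonneg_eq_0_iff)
  then show ?thesis
    using h by (simp add: h(1) disc_cubic_of)
qed

lemma roots_map_cubic_of:
  assumes "h \<in> root_data"
  shows "roots_map (RP3 (cubic_of h)) = rootset h"
proof -
  obtain x y z where h: "h = ((x, y), z)" "(x, y) \<noteq> (0, 0)" "Im z > 0"
    using assms by (metis mem_root_data surj_pair)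
  have nz: "cubic_of h \<noteq> 0"
    using disc_neg_nonzero[OF disc_cubic_of_neg[OF assms]] .
  have "is_root (RP3 (cubic_of h)) P \<longleftrightarrow> P \<in> rootset h" for P
  proof -
    obtain X Y where P: "P = CP1 (X, Y)" "(X, Y) \<noteq> (0, 0)"
      by (rule CP1_cases)
    have "P \<in> rootset h \<longleftrightarrow>
        P = CP1 (of_real x, of_real y) \<or> P = CP1 (z, 1) \<or> P = CP1 (cnj z, 1)"
      by (auto simp: rootset_def h(1) cp1_of_def)
    also have "\<dots> \<longleftrightarrow> X * of_real y = of_real x * Y \<or> X = z * Y \<or> X = cnj z * Y"
      using h(2) P(2) unfolding P(1) by (subst (1 2 3) CP1_eq_iff) auto
    also have "\<dots> \<longleftrightarrow> binary_cubic (cubic_of h) X Y = 0"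
      by (auto simp: h(1) binary_cubic_cubic_of mult.commute)
    finally show ?thesis
      using is_root_RP3[OF nz P(2)] P(1) by simp
  qed
  then show ?thesis
    by (auto simp: roots_map_def)
qed

lemma real_cubic_has_root: "\<exists>t :: real. t ^ 3 + b * t\<^sup>2 + c * t + d = 0"
proof -
  define f where "f t = t ^ 3 + b * t\<^sup>2 + c * t + d" for t
  \<comment> \<open>Beyond this bound the leading term dominates: the lower terms are at most
    \<open>(K - 1) * K\<^sup>2\<close> in absolute value, so the sign changes between
    \<open>- K\<close> and \<open>K\<close>.\<close>
  define K where "K = 1 + \<bar>b\<bar> + \<bar>c\<bar> + \<bar>d\<bar>"
  have K: "K \<ge> 1"
    by (simp add: K_def)
  then have K2: "K \<le> K\<^sup>2" "1 \<le> K\<^sup>2"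
    using mult_mono[of 1 K 1 K] by (simp_all add: power2_eq_square)
  have "\<bar>b * K\<^sup>2\<bar> \<le> \<bar>b\<bar> * K\<^sup>2" "\<bar>c * K\<bar> \<le> \<bar>c\<bar> * K\<^sup>2" "\<bar>d\<bar> \<le> \<bar>d\<bar> * K\<^sup>2"
    using K K2 by (simp_all add: abs_mult mult_left_mono mult_le_cancel_left1)
  moreover have "\<bar>b\<bar> * K\<^sup>2 + \<bar>c\<bar> * K\<^sup>2 + \<bar>d\<bar> * K\<^sup>2 = K ^ 3 - K\<^sup>2"
    by (simp add: K_def algebra_simps power2_eq_square power3_eq_cube)
  ultimately have "\<bar>b * K\<^sup>2\<bar> + \<bar>c * K\<bar> + \<bar>d\<bar> \<le> K ^ 3"
    using K2 by linarith
  then have "f (- K) \<le> 0" "0 \<le> f K"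
    by (simp_all add: f_def)
  moreover have "continuous_on {- K..K} f"
    unfolding f_def by (intro continuous_intros)
  ultimately have "\<exists>t. -K \<le> t \<and> t \<le> K \<and> f t = 0"
    using IVT'[of f "- K" 0 K] K by simp
  then show ?thesis
    by (auto simp: f_def)
qed

lemma cubic_of_surj:
  assumes "disc q < 0"
  shows "\<exists>h\<in>root_data. \<exists>s. s \<noteq> 0 \<and> q = s *\<^sub>R cubic_of h"
proof -
  obtain a b c d where q: "q = (a, b, c, d)"
    by (metis surj_pair)
  have disc: "cubic_disc a b c d < 0"
    using assms by (simp add: q disc_def)
  show ?thesis
  proof (cases "a = 0")
    case True
    \<comment> \<open>Here the real root is infinity, with coordinates \<open>(1, 0)\<close>, and
      the other factor is the quadratic form with coefficients \<open>b, c, d\<close>, of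
      discriminant \<open>c\<^sup>2 - 4 * b * d\<close>.\<close>
    have dis: "b\<^sup>2 * (c\<^sup>2 - 4 * b * d) < 0"
      using disc by (simp add: cubic_disc_def True algebra_simps power2_eq_square power3_eq_cube)
    then have b: "b \<noteq> 0" and cbd: "c\<^sup>2 - 4 * b * d < 0"
      by (auto simp: mult_less_0_iff)
    define v where "v = sqrt (4 * b * d - c\<^sup>2) / (2 * \<bar>b\<bar>)"
    have v: "v > 0" "v\<^sup>2 = (4 * b * d - c\<^sup>2) / (4 * b\<^sup>2)"
      using b cbd by (simp_all add: v_def power_divide power_mult_distrib)
    let ?h = "((1, 0), Complex (- c / (2 * b)) v)"
    have "?h \<in> root_data"
      using v by (simp add: mem_root_data)
    have "b * (c / (2 * b))\<^sup>2 + b * v\<^sup>2 = d"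
      unfolding v(2) using b by (simp add: field_simps power2_eq_square)
    \<comment> \<open>The sign arises because the linear factor of \<open>cubic_of\<close> at
      \<open>(1, 0)\<close> is \<open>- Y\<close>.\<close>
    then have "q = (- b) *\<^sub>R cubic_of ?h"
      using b by (simp add: q True cubic_of_def Let_def right_diff_distrib)
    with \<open>?h \<in> root_data\<close> b show ?thesis
      by (metis neg_equal_0_iff_equal)
  next
    case False
    obtain t where "t ^ 3 + (b / a) * t\<^sup>2 + (c / a) * t + d / a = 0"
      using real_cubic_has_root by blast
    then have "a * t ^ 3 + b * t\<^sup>2 + c * t + d = 0"
      using False by (simp add: field_simps)
    then have d: "d = - (a * t ^ 3 + b * t\<^sup>2 + c * t)" by simp
    \<comment> \<open>Synthetic division by the real root: the cubic is \<open>(X - t Y)\<close>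
      times the quadratic form with coefficients \<open>a, e, f\<close>.\<close>
    define e where "e = b + a * t"
    define f where "f = c + e * t"
    have bc: "b = e - a * t" "c = f - e * t" "d = - f * t"
      by (simp_all add: e_def f_def d algebra_simps power2_eq_square power3_eq_cube)
    \<comment> \<open>Discriminant of a product: that of the quadratic factor times its squared
      value at \<open>t\<close>. Being negative, it forces the first factor to be negative.\<close>
    have "cubic_disc a b c d = (e\<^sup>2 - 4 * a * f) * (a * t\<^sup>2 + e * t + f)\<^sup>2"
      unfolding bc cubic_disc_def by algebra
    then have eaf: "e\<^sup>2 - 4 * a * f < 0"
      using disc by (auto simp: mult_less_0_iff)
    \<comment> \<open>The imaginary part from the quadratic formula; \<open>\<bar>a\<bar>\<close>
      selects the root in the upper half plane.\<close>
    define v where "v = sqrt (4 * a * f - e\<^sup>2) / (2 * \<bar>a\<bar>)"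
    have v: "v > 0" "v\<^sup>2 = (4 * a * f - e\<^sup>2) / (4 * a\<^sup>2)"
      using False eaf by (simp_all add: v_def power_divide power_mult_distrib)
    let ?h = "((t, 1), Complex (- e / (2 * a)) v)"
    have "?h \<in> root_data"
      using v by (simp add: mem_root_data)
    moreover have "(e / (2 * a))\<^sup>2 + v\<^sup>2 = f / a"
      unfolding v(2) using False by (simp add: field_simps power2_eq_square)
    then have "q = a *\<^sub>R cubic_of ?h"
      using False by (simp add: q bc cubic_of_def Let_def distrib_left right_diff_distrib)
    ultimately show ?thesis
      using False by blast
  qed
qed

lemma UTH2_Coefs_cubic_of: "UTH2_Coefs = (\<lambda>h. RP3 (cubic_of h)) ` root_data"
proof (intro set_eqI iffI)
  fix p assume "p \<in> UTH2_Coefs"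
  then obtain q where q: "p = RP3 q" "disc q < 0"
    by (auto simp: UTH2_Coefs_eq)
  then obtain h s where h: "h \<in> root_data" "s \<noteq> 0" "q = s *\<^sub>R cubic_of h"
    using cubic_of_surj by blast
  then have "RP3 (cubic_of h) = RP3 q"
    using disc_neg_nonzero disc_cubic_of_neg q(2) by (subst RP3_eq_iff) blast+
  then show "p \<in> (\<lambda>h. RP3 (cubic_of h)) ` root_data"
    using h(1) q(1) by (metis image_eqI)
qed (auto simp: UTH2_Coefs_eq disc_cubic_of_neg)

lemma RP3_cubic_of_cong:
  assumes "h \<in> root_data" "h' \<in> root_data" "rootset h = rootset h'"
  shows "RP3 (cubic_of h) = RP3 (cubic_of h')"
proof -
  obtain x y z where h: "h = ((x, y), z)" "(x, y) \<noteq> (0, 0)"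
    using assms(1) by (metis mem_root_data surj_pair)
  obtain x' y' z' where h': "h' = ((x', y'), z')" "(x', y') \<noteq> (0, 0)"
    using assms(2) by (metis mem_root_data surj_pair)
  have z: "z = z'" and xy: "x * y' = x' * y"
    using rootset_eqD assms unfolding h h' by metis+
  obtain t where t: "t \<noteq> 0" "x' = t * x" "y' = t * y"
  proof (cases "x = 0")
    case True
    then show ?thesis
      using that[of "y' / y"] h(2) h'(2) xy by auto
  next
    case False
    then have "x' \<noteq> 0"
      using h'(2) xy by auto
    then show ?thesis
      using that[of "x' / x"] False xy by (auto simp: field_simps)
  qed
  have "cubic_of h' = t *\<^sub>R cubic_of h"
    by (simp add: h h' z t cubic_of_def Let_def algebra_simps)
  then show ?thesis
    using t(1) disc_neg_nonzero disc_cubic_of_neg assms by (subst RP3_eq_iff) blast+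
qed

text \<open>Both spaces are images of \<open>root_data\<close>, and over this parametrization
  \<open>roots_map\<close> sends the class of \<open>cubic_of h\<close> to \<open>rootset h\<close>.
  Injectivity then says that root data with equal root sets have proportional cubics.\<close>

lemma bij_betw_roots_map: "bij_betw roots_map UTH2_Coefs UTH2_Roots"
proof (rule bij_betw_imageI)
  show "inj_on roots_map UTH2_Coefs"
    by (rule inj_onI) (auto simp: UTH2_Coefs_cubic_of roots_map_cubic_of intro: RP3_cubic_of_cong)
  show "roots_map ` UTH2_Coefs = UTH2_Roots"
    by (simp add: UTH2_Coefs_cubic_of UTH2_Roots_eq image_image roots_map_cubic_of cong: image_cong_simp)
qed

section \<open>Simple transitivity\<close>

lemma rootset_base: "rootset ((0, 1), \<i>) = roots_base" "((0, 1), \<i>) \<in> root_data"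
  by (auto simp: rootset_def roots_base_def cp1_of_def mem_root_data)

text \<open>The condition that \<open>z\<close> goes to \<open>\<i>\<close> is
  \<open>k * z + l = \<i> * (m * z + n)\<close>, whose real and imaginary parts give
  \<open>l\<close> and \<open>n\<close> linearly in \<open>k\<close> and \<open>m\<close>.
  Substituting \<open>l\<close> into \<open>k * x + l * y = 0\<close> leaves one linear condition on
  \<open>(k, m)\<close>.\<close>

lemma act_root_data_base_iff:
  assumes S: "det S = 1" and h: "((x, y), z) \<in> root_data"
  defines "k \<equiv> S$1$1" and "l \<equiv> S$1$2" and "m \<equiv> S$2$1" and "n \<equiv> S$2$2"
  shows "roots_act (abs_psl2r S) (rootset ((x, y), z)) = roots_base \<longleftrightarrow>
    k * (x - y * Re z) = m * (y * Im z) \<and> l = - m * Im z - k * Re z \<and> n = k * Im z - m * Re z"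
proof -
  define p q where pq: "p = Re z" "q = Im z"
  define b a D where baD: "b = k * p + l" "a = m * p + n" "D = a\<^sup>2 + (m * q)\<^sup>2"
  have q: "q > 0"
    using h by (simp add: mem_root_data pq)
  have det: "k * a - m * b = 1"
    using S by (simp add: baD k_def l_def m_def n_def det_2 algebra_simps)
  have D: "D > 0"
    using act_root_data_denominator[OF S, of z] q by (simp add: baD pq m_def n_def)
  have closed: "act_root_data S ((x, y), z) \<in> root_data"
    using act_root_data_closed[OF S h] .
  have act: "act_root_data S ((x, y), z) =
      ((k * x + l * y, m * x + n * y), Complex ((b * a + k * m * q\<^sup>2) / D) (q / D))"
    by (simp add: act_root_data_def Let_def baD pq k_def l_def m_def n_def)
  have "roots_act (abs_psl2r S) (rootset ((x, y), z)) = roots_base \<longleftrightarrow>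
      rootset (act_root_data S ((x, y), z)) = rootset ((0, 1), \<i>)"
    using roots_act_rootset[OF S h] rootset_base by simp
  also have "\<dots> \<longleftrightarrow> k * x + l * y = 0 \<and> Complex ((b * a + k * m * q\<^sup>2) / D) (q / D) = \<i>"
    using rootset_eqD[of "k * x + l * y" "m * x + n * y" _ 0 1 \<i>]
      rootset_eqI[of "k * x + l * y" "m * x + n * y" \<i> 0 1] closed rootset_base(2)
    unfolding act by auto
  also have "\<dots> \<longleftrightarrow> k * x + l * y = 0 \<and> b * a + k * m * q\<^sup>2 = 0 \<and> q = D"
    using D by (auto simp: complex_eq_iff)
  also have "\<dots> \<longleftrightarrow> k * x + l * y = 0 \<and> b = - m * q \<and> a = k * q"
  proof -
    have "b = - m * q \<and> a = k * q" if "b * a + k * m * q\<^sup>2 = 0" "q = D"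
    proof -
      \<comment> \<open>Replace the outer \<open>q\<close> by \<open>D\<close>, eliminate
        \<open>b * a\<close> by the first equation, and the determinant condition cancels what
        remains.\<close>
      have "q * (b + m * q) = 0" "q * (a - k * q) = 0"
        using that det unfolding baD(3) by algebra+
      then show ?thesis using q by auto
    qed
    moreover have "b * a + k * m * q\<^sup>2 = 0 \<and> q = D" if "b = - m * q" "a = k * q"
      using that det unfolding baD(3) by algebra
    ultimately show ?thesis by blast
  qed
  also have "\<dots> \<longleftrightarrow> k * (x - y * p) = m * (y * q) \<and> l = - m * q - k * p \<and> n = k * q - m * p"
  proof -
    have "k * x + l * y = k * (x - y * p) - m * (y * q)" if "b = - m * q"
      using that unfolding baD by algebra
    moreover have "b = - m * q \<longleftrightarrow> l = - m * q - k * p" "a = k * q \<longleftrightarrow> n = k * q - m * p"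
      by (auto simp: baD)
    ultimately show ?thesis by auto
  qed
  finally show ?thesis
    by (simp add: pq)
qed

text \<open>For vectors of equal norm, the product of the squared norms of their difference and sum
  is four times the squared determinant of the pair, by Lagrange's identity.\<close>

lemma parallel_same_norm:
  fixes k m k' m' :: real
  assumes "k * m' = k' * m" "k\<^sup>2 + m\<^sup>2 = k'\<^sup>2 + m'\<^sup>2"
  shows "(k' = k \<and> m' = m) \<or> (k' = - k \<and> m' = - m)"
proof -
  have "((k - k')\<^sup>2 + (m - m')\<^sup>2) * ((k + k')\<^sup>2 + (m + m')\<^sup>2) = 0"
    using assms by algebra
  then show ?thesis
    by (auto simp: add_nonneg_eq_0_iff)
qed

lemma roots_simply_transitive:
  assumes "s \<in> UTH2_Roots"
  shows "\<exists>!T. roots_act T s = roots_base"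
proof -
  obtain x y z where s: "s = rootset ((x, y), z)" "((x, y), z) \<in> root_data"
    using assms unfolding UTH2_Roots_eq by (metis imageE surj_pair)
  define p q X Y where pq: "p = Re z" "q = Im z" "X = x - y * Re z" "Y = y * Im z"
  have q: "q > 0" and XY: "X\<^sup>2 + Y\<^sup>2 > 0"
    using s(2) by (auto simp: mem_root_data pq sum_power2_gt_zero_iff)
  show ?thesis
  proof (rule ex_ex1I)
    \<comment> \<open>The linear condition makes the first column of the matrix a multiple
      \<open>c\<close> of \<open>(Y, X)\<close>; the determinant is then
      \<open>c\<^sup>2 * r\<close>, which fixes \<open>c\<close> up to sign.\<close>
    define r where "r = q * (X\<^sup>2 + Y\<^sup>2)"
    define c where "c = 1 / sqrt r"
    have "r > 0"
      using q XY by (simp add: r_def)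
    then have c: "c\<^sup>2 * (q * (X\<^sup>2 + Y\<^sup>2)) = 1"
      by (simp add: c_def power_divide flip: r_def)
    define S :: "real^2^2" where "S = vector [vector [c * Y, - (c * X) * q - (c * Y) * p],
      vector [c * X, (c * Y) * q - (c * X) * p]]"
    have "det S = 1"
      using c by (simp add: S_def det_2 algebra_simps power2_eq_square)
    then have "roots_act (abs_psl2r S) s = roots_base"
      unfolding s(1) by (subst act_root_data_base_iff[OF _ s(2)]) (simp_all add: S_def pq algebra_simps)
    then show "\<exists>T. roots_act T s = roots_base" by blast
  next
    fix T T' assume T: "roots_act T s = roots_base" and T': "roots_act T' s = roots_base"
    obtain S S' where S: "T = abs_psl2r S" "det S = 1" and S': "T' = abs_psl2r S'" "det S' = 1"
      by (metis psl2r_cases)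
    have eqs: "S$1$1 * X = S$2$1 * Y" "S$1$2 = - S$2$1 * q - S$1$1 * p" "S$2$2 = S$1$1 * q - S$2$1 * p"
      using T act_root_data_base_iff[OF S(2) s(2)] by (simp_all add: s(1) S(1) pq)
    have eqs': "S'$1$1 * X = S'$2$1 * Y" "S'$1$2 = - S'$2$1 * q - S'$1$1 * p" "S'$2$2 = S'$1$1 * q - S'$2$1 * p"
      using T' act_root_data_base_iff[OF S'(2) s(2)] by (simp_all add: s(1) S'(1) pq)
    \<comment> \<open>Both first columns are multiples of \<open>(Y, X)\<close>, hence parallel, and
      determinant 1 gives them the same norm. They agree up to sign, which is invisible in
      \<open>psl2r\<close>.\<close>
    have "S$1$1 * S'$2$1 * (X\<^sup>2 + Y\<^sup>2) = S'$1$1 * S$2$1 * (X\<^sup>2 + Y\<^sup>2)"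
      using eqs(1) eqs'(1) by algebra
    then have par: "S$1$1 * S'$2$1 = S'$1$1 * S$2$1"
      by (metis XY less_irrefl mult_right_cancel)
    have "q * ((S$1$1)\<^sup>2 + (S$2$1)\<^sup>2) = 1" "q * ((S'$1$1)\<^sup>2 + (S'$2$1)\<^sup>2) = 1"
      using S(2) S'(2) unfolding det_2 eqs(2,3) eqs'(2,3) by algebra+
    then have "(S$1$1)\<^sup>2 + (S$2$1)\<^sup>2 = (S'$1$1)\<^sup>2 + (S'$2$1)\<^sup>2"
      by (metis q less_irrefl mult_left_cancel)
    then have "(S'$1$1 = S$1$1 \<and> S'$2$1 = S$2$1) \<or> (S'$1$1 = - S$1$1 \<and> S'$2$1 = - S$2$1)"
      by (rule parallel_same_norm[OF par])
    then have "S' = S \<or> S' = - S"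
      using eqs eqs' by (auto simp: vec_eq_iff forall_2)
    then show "T = T'"
      using S S' abs_psl2r_uminus by auto
  qed
qed

lemma coefs_act_in: "p \<in> UTH2_Coefs \<Longrightarrow> coefs_act T p \<in> UTH2_Coefs"
proof -
  assume "p \<in> UTH2_Coefs"
  then obtain q where q: "p = RP3 q" "disc q < 0"
    by (auto simp: UTH2_Coefs_eq)
  obtain S where S: "T = abs_psl2r S" "det S = 1"
    by (rule psl2r_cases)
  show ?thesis
    using q S disc_cubic_subst[of "matrix_inv S" q] matrix_inv_det_1(3)[OF S(2)]
    by (auto simp: UTH2_Coefs_eq coefs_act_RP3 disc_neg_nonzero)
qed

lemma roots_act_in: "s \<in> UTH2_Roots \<Longrightarrow> roots_act T s \<in> UTH2_Roots"
  by (rule psl2r_cases[of T]) (auto simp: UTH2_Roots_eq roots_act_rootset act_root_data_closed)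

lemma coefs_base_eq: "coefs_base = RP3 (cubic_of ((0, 1), \<i>))"
  by (simp add: coefs_base_def cubic_of_def Let_def)

lemma coefs_base_in: "coefs_base \<in> UTH2_Coefs"
  using rootset_base(2) by (auto simp: coefs_base_eq UTH2_Coefs_cubic_of)

lemma roots_map_base: "roots_map coefs_base = roots_base"
  using rootset_base by (simp add: coefs_base_eq roots_map_cubic_of)

text \<open>By equivariance and injectivity of \<open>roots_map\<close>, the same group elements
  solve the problem for a cubic and for its root set.\<close>

lemma coefs_simply_transitive:
  assumes "p \<in> UTH2_Coefs"
  shows "\<exists>!T. coefs_act T p = coefs_base"
proof -
  have "roots_act T (roots_map p) = roots_base \<longleftrightarrow> coefs_act T p = coefs_base" for T
    using inj_on_eq_iff[OF bij_betw_imp_inj_on[OF bij_betw_roots_map] coefs_act_in[OF assms] coefs_base_in]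
    by (simp add: roots_map_base roots_map_coefs_act)
  moreover have "roots_map p \<in> UTH2_Roots"
    using bij_betw_roots_map assms by (rule bij_betw_apply)
  ultimately show ?thesis
    using roots_simply_transitive[of "roots_map p"] by simp
qed

section \<open>Both spaces as homogeneous manifolds\<close>

lemma homogeneous_manifold_coefs:
  "homogeneous_manifold UTH2_Coefs coefs_atlas coefs_act coefs_base monic_chart"
proof
  show "inj_on (chart_fun c) (chart_dom c)" if "c \<in> coefs_atlas" for c
    using quotient_chart_coefs_atlas[OF that] quotient_chart.inj by blast
  show "chart_dom c \<subseteq> UTH2_Coefs" if "c \<in> coefs_atlas" for c
    using quotient_chart_coefs_atlas[OF that] quotient_chart.chart_dom_eq
    unfolding UTH2_Coefs_eq by fastforce
  show "charts_at coefs_atlas p \<noteq> {}" if UT: "p \<in> UTH2_Coefs" for p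
  proof -
    obtain a b c d where p: "p = RP3 (a, b, c, d)" "cubic_disc a b c d < 0"
      using UT by (auto simp: UTH2_Coefs_def)
    show ?thesis
    proof (cases "a = 0")
      case True
      \<comment> \<open>The discriminant vanishes if both leading coefficients do.\<close>
      then have "b \<noteq> 0"
        using p by (auto simp: cubic_disc_def)
      then have "({RP3 (a, b, c, d) | a b c d. cubic_disc a b c d < 0 \<and> b \<noteq> 0}, aff_b) \<in> charts_at coefs_atlas p"
        using p by (auto simp: charts_at_def coefs_atlas_def)
      then show ?thesis by blast
    next
      case False
      then have "monic_chart \<in> charts_at coefs_atlas p"
        using p by (auto simp: charts_at_def coefs_atlas_def monic_chart_def)
      then show ?thesis by blast
    qed
  qed
  have "coefs_base = RP3 (1, 0, 1, 0) \<and> cubic_disc 1 0 1 0 < 0 \<and> (1 :: real) \<noteq> 0"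
    by (simp add: coefs_base_def cubic_disc_def)
  then have "coefs_base \<in> chart_dom monic_chart"
    unfolding monic_chart_def fst_conv by blast
  then show "monic_chart \<in> charts_at coefs_atlas coefs_base"
    by (simp add: charts_at_def coefs_atlas_def)
  show "smooth_in_charts c d (coefs_act T) p"
    if cd: "c \<in> charts_at coefs_atlas p" "d \<in> charts_at coefs_atlas (coefs_act T p)" for c d T p
  proof -
    obtain S where S: "T = abs_psl2r S" "det S = 1"
      by (rule psl2r_cases)
    obtain \<kappa> \<pi> \<sigma> \<kappa>' \<pi>' \<sigma>' where
      c: "quotient_chart RP3 {q. disc q < 0} c \<kappa> \<pi> \<sigma>" "p \<in> chart_dom c" and
      d: "quotient_chart RP3 {q. disc q < 0} d \<kappa>' \<pi>' \<sigma>'" "coefs_act T p \<in> chart_dom d"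
      using cd quotient_chart_coefs_atlas[of c] quotient_chart_coefs_atlas[of d]
      by (auto simp: charts_at_def)
    show ?thesis
    proof (rule smooth_in_charts_lift[OF c(1) d(1), where F="cubic_subst (matrix_inv S)"])
      show "smooth_on {q. disc q < 0} (cubic_subst (matrix_inv S))"
        by (rule smooth_on_cubic_subst[OF open_disc_neg])
      show "cubic_subst (matrix_inv S) h \<in> {q. disc q < 0}" if "h \<in> {q. disc q < 0}" for h
        using that by (simp add: disc_cubic_subst matrix_inv_det_1(3)[OF S(2)])
      show "coefs_act T (RP3 h) = RP3 (cubic_subst (matrix_inv S) h)" if "h \<in> {q. disc q < 0}" for h
        using that S by (simp add: coefs_act_RP3 disc_neg_nonzero)
    qed (fact c(2) d(2))+
  qed
  show "\<exists>T'. \<forall>p\<in>UTH2_Coefs. coefs_act T' (coefs_act T p) = p" for T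
    using psl2r_act_inverse[of T] by (rule ex_forward) simp
qed (fact coefs_base_in coefs_act_in coefs_simply_transitive)+

lemma homogeneous_manifold_roots:
  "homogeneous_manifold UTH2_Roots roots_atlas roots_act roots_base finite_chart"
proof
  show "inj_on (chart_fun c) (chart_dom c)" if "c \<in> roots_atlas" for c
    using quotient_chart_roots_atlas[OF that] quotient_chart.inj by blast
  show "chart_dom c \<subseteq> UTH2_Roots" if "c \<in> roots_atlas" for c
    using that by (auto simp: roots_atlas_def finite_chart_def infinite_chart_def)
  have "cp1_of 0 \<noteq> cp1_inf"
    by (simp add: cp1_of_def cp1_inf_def CP1_eq_iff)
  show "charts_at roots_atlas s \<noteq> {}" if "s \<in> UTH2_Roots" for s
  proof -
    have "s \<in> chart_dom finite_chart \<or> s \<in> chart_dom infinite_chart"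
      using that \<open>cp1_of 0 \<noteq> cp1_inf\<close> by (auto simp: finite_chart_def infinite_chart_def)
    then have "finite_chart \<in> charts_at roots_atlas s \<or> infinite_chart \<in> charts_at roots_atlas s"
      by (simp add: charts_at_def roots_atlas_def)
    then show ?thesis by blast
  qed
  show base: "roots_base \<in> UTH2_Roots"
    using rootset_base by (auto simp: UTH2_Roots_eq image_iff)
  have "real_root roots_base = cp1_of 0"
    using real_root_rootset[OF rootset_base(2)] by (simp add: rootset_base(1) cp1_of_def)
  then show "finite_chart \<in> charts_at roots_atlas roots_base"
    using base \<open>cp1_of 0 \<noteq> cp1_inf\<close> by (simp add: charts_at_def roots_atlas_def finite_chart_def)
  show "smooth_in_charts c d (roots_act T) s"
    if cd: "c \<in> charts_at roots_atlas s" "d \<in> charts_at roots_atlas (roots_act T s)" for c d T s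
  proof -
    obtain S where S: "T = abs_psl2r S" "det S = 1"
      by (rule psl2r_cases)
    obtain \<kappa> \<pi> \<sigma> \<kappa>' \<pi>' \<sigma>' where
      c: "quotient_chart rootset root_data c \<kappa> \<pi> \<sigma>" "s \<in> chart_dom c" and
      d: "quotient_chart rootset root_data d \<kappa>' \<pi>' \<sigma>'" "roots_act T s \<in> chart_dom d"
      using cd quotient_chart_roots_atlas[of c] quotient_chart_roots_atlas[of d]
      by (auto simp: charts_at_def)
    show ?thesis
      by (rule smooth_in_charts_lift[OF c(1) d(1), where F="act_root_data S"])
        (use c(2) d(2) S in \<open>simp_all add: smooth_act_root_data act_root_data_closed roots_act_rootset\<close>)
  qed
  show "\<exists>T'. \<forall>s\<in>UTH2_Roots. roots_act T' (roots_act T s) = s" for T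
    using psl2r_act_inverse[of T] by (rule ex_forward) simp
qed (fact roots_act_in roots_simply_transitive)+

section \<open>The roots of a monic cubic as functions of its coefficients\<close>

text \<open>The lower coefficients of \<open>(X - t) (X - z) (X - cnj z)\<close>: the inverse of the
  roots map, read in the finite and the monic chart.\<close>

definition vieta :: "real \<times> complex \<Rightarrow> real \<times> real \<times> real" where
  "vieta = (\<lambda>(t, z). (- t - 2 * Re z, (Re z)\<^sup>2 + (Im z)\<^sup>2 + 2 * t * Re z, - ((Re z)\<^sup>2 + (Im z)\<^sup>2) * t))"

definition vieta_deriv :: "real \<times> complex \<Rightarrow> real \<times> complex \<Rightarrow> real \<times> real \<times> real" where
  "vieta_deriv = (\<lambda>(t, z) (\<tau>, \<zeta>). let \<mu> = 2 * Re z * Re \<zeta> + 2 * Im z * Im \<zeta> in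
     (- \<tau> - 2 * Re \<zeta>, \<mu> + 2 * \<tau> * Re z + 2 * t * Re \<zeta>, - \<mu> * t - ((Re z)\<^sup>2 + (Im z)\<^sup>2) * \<tau>))"

text \<open>Perturbing the cubic \<open>f\<close> by \<open>u x\<^sup>2 + v x + w\<close> moves its root \<open>t\<close> by \<open>- (u t\<^sup>2 + v t + w) / f' t\<close>,
  where \<open>f' t = \<bar>t - z\<bar>\<^sup>2\<close>; the motion of \<open>z\<close> is read off the sum of the roots and the middle coefficient.\<close>

definition roots_deriv :: "real \<times> complex \<Rightarrow> real \<times> real \<times> real \<Rightarrow> real \<times> complex" where
  "roots_deriv = (\<lambda>(t, z) (u, v, w).
     let \<tau> = - (u * t\<^sup>2 + v * t + w) / ((t - Re z)\<^sup>2 + (Im z)\<^sup>2); \<rho> = - (u + \<tau>) / 2 in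
     (\<tau>, Complex \<rho> ((v - 2 * Re z * \<rho> - 2 * \<tau> * Re z - 2 * t * \<rho>) / (2 * Im z))))"

lemma has_derivative_vieta: "(vieta has_derivative vieta_deriv x) (at x)"
proof -
  obtain t z where x: "x = (t, z)" by (cases x)
  show ?thesis
    unfolding vieta_def vieta_deriv_def case_prod_beta x Let_def
    by (auto intro!: derivative_eq_intros ext simp: algebra_simps power2_eq_square)
qed

text \<open>A left inverse of the derivative is the form in which the rule for differentiating an
  inverse map takes this information.\<close>

lemma roots_deriv_vieta_deriv:
  assumes "Im (snd x) \<noteq> 0"
  shows "roots_deriv x \<circ> vieta_deriv x = id"
proof
  fix h :: "real \<times> complex"
  obtain t z where x: "x = (t, z)" by (cases x)
  obtain \<tau> \<zeta> where h: "h = (\<tau>, \<zeta>)" by (cases h)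
  define n where "n = (t - Re z)\<^sup>2 + (Im z)\<^sup>2"
  have n: "n > 0" and q: "Im z \<noteq> 0"
    using assms by (simp_all add: n_def x add_nonneg_pos)
  obtain u v w where uvw: "vieta_deriv x h = (u, v, w)"
    by (metis surj_pair)
  then have eqs: "u = - \<tau> - 2 * Re \<zeta>" "v = 2 * Re z * Re \<zeta> + 2 * Im z * Im \<zeta> + 2 * \<tau> * Re z + 2 * t * Re \<zeta>"
    "w = - (2 * Re z * Re \<zeta> + 2 * Im z * Im \<zeta>) * t - ((Re z)\<^sup>2 + (Im z)\<^sup>2) * \<tau>"
    by (auto simp: vieta_deriv_def x h Let_def algebra_simps)
  \<comment> \<open>Vary the factors of \<open>(X - t) (X - z) (X - cnj z)\<close> and evaluate at
    \<open>X = t\<close>: only the term where \<open>X - t\<close> is varied survives, namely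
    \<open>- \<tau>\<close> times the squared distance \<open>n\<close> from \<open>t\<close> to
    \<open>z\<close>.\<close>
  have "- (u * t\<^sup>2 + v * t + w) = \<tau> * n"
    unfolding eqs n_def by algebra
  then have \<tau>: "- (u * t\<^sup>2 + v * t + w) / n = \<tau>"
    using n by simp
  have \<rho>: "- (u + \<tau>) / 2 = Re \<zeta>"
    by (simp add: eqs)
  have \<sigma>: "(v - 2 * Re z * Re \<zeta> - 2 * \<tau> * Re z - 2 * t * Re \<zeta>) / (2 * Im z) = Im \<zeta>"
    using q by (simp add: eqs)
  have "roots_deriv x (u, v, w) = (\<tau>, Complex (Re \<zeta>) (Im \<zeta>))"
    unfolding roots_deriv_def x prod.case Let_def n_def[symmetric] \<tau> \<rho> \<sigma> ..
  then show "(roots_deriv x \<circ> vieta_deriv x) h = id h"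
    by (simp add: h uvw[unfolded h])
qed

lemma bounded_linear_roots_deriv: "bounded_linear (roots_deriv x)"
proof -
  obtain t z where x: "x = (t, z)" by (cases x)
  have "linear (roots_deriv x)"
  proof (rule linearI)
    show "roots_deriv x (a + b) = roots_deriv x a + roots_deriv x b" for a b
      by (cases a; cases b) (simp add: x roots_deriv_def Let_def complex_eq_iff add_divide_distrib
          diff_divide_distrib algebra_simps)
    show "roots_deriv x (r *\<^sub>R a) = r *\<^sub>R roots_deriv x a" for r a
      by (cases a) (simp add: x roots_deriv_def Let_def complex_eq_iff add_divide_distrib
          diff_divide_distrib algebra_simps)
  qed
  then show ?thesis
    by (simp add: linear_conv_bounded_linear)
qed

section \<open>The roots of a monic cubic: continuity, derivative, smoothness\<close>

definition monic_domain :: "(real \<times> real \<times> real) set" where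
  "monic_domain = {y. disc (1, y) < 0}"

definition monic_roots :: "real \<times> real \<times> real \<Rightarrow> real \<times> complex" where
  "monic_roots y = chart_fun finite_chart (roots_map (RP3 (1, y)))"

lemma cubic_of_vieta: "cubic_of ((t, 1), z) = (1, vieta (t, z))"
  by (simp add: cubic_of_def vieta_def Let_def algebra_simps)

lemma monic_roots_vieta:
  assumes "Im z > 0"
  shows "monic_roots (vieta (t, z)) = (t, z)" "vieta (t, z) \<in> monic_domain"
proof -
  have h: "((t, 1), z) \<in> root_data"
    using assms by (simp add: mem_root_data)
  then show "monic_roots (vieta (t, z)) = (t, z)"
    using roots_map_cubic_of[OF h] quotient_chart.chart_fun_eq[OF quotient_chart_finite h]
    by (simp add: monic_roots_def cubic_of_vieta)
  show "vieta (t, z) \<in> monic_domain"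
    using disc_cubic_of_neg[OF h] by (simp add: monic_domain_def cubic_of_vieta)
qed

lemma vieta_surj:
  assumes "y \<in> monic_domain"
  shows "\<exists>t z. Im z > 0 \<and> y = vieta (t, z)"
proof -
  obtain h s where h: "h \<in> root_data" "s \<noteq> 0" "(1, y) = s *\<^sub>R cubic_of h"
    using cubic_of_surj[of "(1, y)"] assms by (auto simp: monic_domain_def)
  obtain a b z where hz: "h = ((a, b), z)"
    by (metis surj_pair)
  have sb: "s * b = 1"
    using h(3) by (simp add: hz cubic_of_def Let_def)
  then have "b \<noteq> 0" by auto
  with sb have s: "s = 1 / b"
    by (simp add: eq_divide_eq)
  have "y = vieta (a / b, z)"
    using h(3) \<open>b \<noteq> 0\<close> by (cases y) (simp add: hz s cubic_of_def vieta_def Let_def field_simps)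
  then show ?thesis
    using h(1) by (auto simp: hz mem_root_data)
qed

lemma monic_domain_eq: "monic_domain = vieta ` {x. Im (snd x) > 0}"
  using vieta_surj monic_roots_vieta(2) by (fastforce simp: image_iff)

lemma open_upper: "open {x :: real \<times> complex. Im (snd x) > 0}"
  by (intro open_Collect_less continuous_intros)

lemma monic_roots:
  assumes "y \<in> monic_domain"
  shows "Im (snd (monic_roots y)) > 0" "vieta (monic_roots y) = y"
  using vieta_surj[OF assms] monic_roots_vieta(1) by auto

lemma open_monic_domain: "open monic_domain"
proof -
  have "continuous_on UNIV (\<lambda>y. disc (1, y))"
    by (intro continuous_on_compose2[OF continuous_disc] continuous_intros) auto
  from open_Collect_less[OF this continuous_on_const] show ?thesis
    by (simp add: monic_domain_def)
qed

text \<open>Invariance of domain: \<open>vieta\<close> is continuous and injective on an open set,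
  between spaces of the same dimension 3, so its inverse is continuous.\<close>

lemma continuous_monic_roots: "continuous_on monic_domain monic_roots"
  unfolding monic_domain_eq
proof (rule continuous_on_inverse_open[OF open_upper])
  show "continuous_on {x. 0 < Im (snd x)} vieta"
    by (intro continuous_at_imp_continuous_on ballI has_derivative_continuous[OF has_derivative_vieta])
qed (auto simp: monic_roots_vieta)

text \<open>The inverse is already known globally and is continuous, so inverting the derivative of
  \<open>vieta\<close> is enough and no local existence argument enters.\<close>

lemma has_derivative_monic_roots:
  assumes "y \<in> monic_domain"
  shows "(monic_roots has_derivative roots_deriv (monic_roots y)) (at y)"
proof (rule has_derivative_inverse_basic[OF has_derivative_vieta bounded_linear_roots_deriv _ _
      open_monic_domain assms])
  show "roots_deriv (monic_roots y) \<circ> vieta_deriv (monic_roots y) = id"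
    using monic_roots(1)[OF assms] by (intro roots_deriv_vieta_deriv) simp
  show "continuous (at y) monic_roots"
    using continuous_monic_roots open_monic_domain assms continuous_on_eq_continuous_at by blast
  show "vieta (monic_roots z) = z" if "z \<in> monic_domain" for z
    using monic_roots(2)[OF that] .
qed

text \<open>The differential equation for the roots expresses their derivatives rationally in the roots
  themselves, so smoothness of every order follows at once.\<close>

lemma smooth_on_monic_roots: "smooth_on monic_domain monic_roots"
proof -
  define t p q where "t y = fst (monic_roots y)" and "p y = Re (snd (monic_roots y))"
    and "q y = Im (snd (monic_roots y))" for y
  define G where "G = {t, p, q}"
  note der = has_derivative_monic_roots
  have dt: "(t has_derivative (\<lambda>h. fst (roots_deriv (monic_roots y) h))) (at y)"
    and dp: "(p has_derivative (\<lambda>h. Re (snd (roots_deriv (monic_roots y) h)))) (at y)"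
    and dq: "(q has_derivative (\<lambda>h. Im (snd (roots_deriv (monic_roots y) h)))) (at y)"
    if "y \<in> monic_domain" for y
    unfolding t_def[abs_def] p_def[abs_def] q_def[abs_def]
    by (intro has_derivative_fst has_derivative_snd has_derivative_Re has_derivative_Im der that)+
  have gen: "t \<in> rational_closure monic_domain G" "p \<in> rational_closure monic_domain G"
    "q \<in> rational_closure monic_domain G"
    by (auto simp: G_def intro: rational_closure.generator)
  have q: "q y > 0" if "y \<in> monic_domain" for y
    using monic_roots(1)[OF that] by (simp add: q_def)
  have rc: "(\<lambda>y. frechet_derivative g (at y) h) \<in> rational_closure monic_domain G"
    if "g \<in> G" for g h
  proof -
    obtain u v w where h: "h = (u, v, w)"
      by (metis surj_pair)
    define \<tau> where "\<tau> y = - (u * (t y)\<^sup>2 + v * t y + w) / ((t y - p y)\<^sup>2 + (q y)\<^sup>2)" for y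
    define \<rho> where "\<rho> y = - (u + \<tau> y) / 2" for y
    define \<sigma> where "\<sigma> y = (v - 2 * p y * \<rho> y - 2 * \<tau> y * p y - 2 * t y * \<rho> y) / (2 * q y)" for y
    note intros = rational_closure.add rational_closure_diff rational_closure.mult
      rational_closure_divide rational_closure_uminus rational_closure_power rational_closure.const gen
    have nz: "(t y - p y)\<^sup>2 + (q y)\<^sup>2 \<noteq> 0" if "y \<in> monic_domain" for y
      using q[OF that] by (simp add: add_nonneg_eq_0_iff)
    have \<tau>: "\<tau> \<in> rational_closure monic_domain G"
      unfolding \<tau>_def[abs_def] by (intro intros nz)
    have \<rho>: "\<rho> \<in> rational_closure monic_domain G"
      unfolding \<rho>_def[abs_def] by (intro intros \<tau>) simp
    have \<sigma>: "\<sigma> \<in> rational_closure monic_domain G"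
      unfolding \<sigma>_def[abs_def] by (intro intros \<tau> \<rho>) (use q in force)
    have eq: "roots_deriv (monic_roots y) h = (\<tau> y, Complex (\<rho> y) (\<sigma> y))" for y
      by (simp add: roots_deriv_def case_prod_beta Let_def h \<tau>_def \<rho>_def \<sigma>_def t_def p_def q_def)
    have fr: "\<tau> y = frechet_derivative t (at y) h" "\<rho> y = frechet_derivative p (at y) h"
      "\<sigma> y = frechet_derivative q (at y) h" if "y \<in> monic_domain" for y
      using frechet_derivative_at[OF dt[OF that], THEN fun_cong, of h]
        frechet_derivative_at[OF dp[OF that], THEN fun_cong, of h]
        frechet_derivative_at[OF dq[OF that], THEN fun_cong, of h] eq[of y] by simp_all
    have "(\<lambda>y. frechet_derivative t (at y) h) \<in> rational_closure monic_domain G"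
      by (rule rational_closure.cong[OF \<tau>]) (rule fr(1))
    moreover have "(\<lambda>y. frechet_derivative p (at y) h) \<in> rational_closure monic_domain G"
      by (rule rational_closure.cong[OF \<rho>]) (rule fr(2))
    moreover have "(\<lambda>y. frechet_derivative q (at y) h) \<in> rational_closure monic_domain G"
      by (rule rational_closure.cong[OF \<sigma>]) (rule fr(3))
    ultimately show ?thesis
      using \<open>g \<in> G\<close> by (auto simp: G_def)
  qed
  have diff: "g differentiable (at y)" if "g \<in> G" "y \<in> monic_domain" for g y
    using that(1) dt[OF that(2), THEN differentiableI] dp[OF that(2), THEN differentiableI]
      dq[OF that(2), THEN differentiableI] by (auto simp: G_def)
  have "smooth_on monic_domain g" if "g \<in> G" for g
    by (rule smooth_on_rational_closure[OF open_monic_domain diff rc rational_closure.generator[OF that]])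
  then have "smooth_on monic_domain (\<lambda>y. (t y, Complex (p y) (q y)))"
    by (intro smooth_on_Pair smooth_on_Complex open_monic_domain) (auto simp: G_def)
  then show ?thesis
    by (simp add: t_def p_def q_def)
qed

section \<open>The roots map and its inverse at the basepoint\<close>

lemma monic_chart_inv:
  assumes "y \<in> monic_domain"
  shows "chart_inv monic_chart y = RP3 (1, y)"
  using quotient_chart.chart_inv_eq[OF quotient_chart_monic, of y] assms
  by (cases y) (simp add: monic_domain_def)

lemma monic_chart_base: "coefs_base \<in> chart_dom monic_chart" "chart_fun monic_chart coefs_base = (0, 1, 0)"
  "(0, 1, 0) \<in> monic_domain"
proof -
  have d: "(1, 0, 1, 0) \<in> {q. disc q < 0}"
    by (simp add: disc_def cubic_disc_def)
  show "chart_fun monic_chart coefs_base = (0, 1, 0)"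
    using quotient_chart.chart_fun_eq[OF quotient_chart_monic d] by (simp add: coefs_base_def)
  show "coefs_base \<in> chart_dom monic_chart"
    using homogeneous_manifold.c0[OF homogeneous_manifold_coefs] by (simp add: charts_at_def)
  show "(0, 1, 0) \<in> monic_domain"
    using d by (simp add: monic_domain_def)
qed

lemma roots_map_in_charts:
  assumes "y \<in> monic_domain"
  shows "(chart_fun finite_chart \<circ> roots_map \<circ> chart_inv monic_chart) y = monic_roots y"
    "roots_map (chart_inv monic_chart y) \<in> chart_dom finite_chart"
proof -
  show "(chart_fun finite_chart \<circ> roots_map \<circ> chart_inv monic_chart) y = monic_roots y"
    using assms by (simp add: monic_chart_inv monic_roots_def)
  obtain t z where z: "Im z > 0" "y = vieta (t, z)"
    using vieta_surj[OF assms] by blast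
  then have "((t, 1), z) \<in> root_data"
    by (simp add: mem_root_data)
  moreover have "chart_inv monic_chart y = RP3 (cubic_of ((t, 1), z))"
    using monic_chart_inv[OF assms] by (simp add: z(2) cubic_of_vieta)
  ultimately show "roots_map (chart_inv monic_chart y) \<in> chart_dom finite_chart"
    by (simp add: quotient_chart.chart_dom_eq[OF quotient_chart_finite] roots_map_cubic_of)
qed

lemma smooth_roots_map_base: "smooth_in_charts monic_chart finite_chart roots_map coefs_base"
  unfolding smooth_in_charts_def
proof (intro conjI exI[of _ monic_domain] ballI)
  show "monic_domain \<subseteq> chart_fun monic_chart ` chart_dom monic_chart"
    unfolding quotient_chart.image[OF quotient_chart_monic] by (auto simp: monic_domain_def)
  show "smooth_on monic_domain (chart_fun finite_chart \<circ> roots_map \<circ> chart_inv monic_chart)"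
    by (rule smooth_on_cong[OF open_monic_domain _ smooth_on_monic_roots])
      (rule roots_map_in_charts(1)[symmetric])
qed (simp_all add: monic_chart_base open_monic_domain roots_map_in_charts(2))

lemma chart_deriv_roots_map_base:
  "chart_deriv monic_chart finite_chart roots_map coefs_base (u, v, w) =
    (- w, Complex ((w - u) / 2) (v / 2))"
proof -
  have base: "monic_roots (0, 1, 0) = (0, \<i>)"
    using monic_roots_vieta(1)[of \<i> 0] by (simp add: vieta_def)
  have "(monic_roots has_derivative roots_deriv (0, \<i>)) (at (0, 1, 0))"
    using has_derivative_monic_roots[OF monic_chart_base(3)] by (simp add: base)
  then have "((chart_fun finite_chart \<circ> roots_map \<circ> chart_inv monic_chart) has_derivative
      roots_deriv (0, \<i>)) (at (0, 1, 0))"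
    by (rule has_derivative_transform_within_open[OF _ open_monic_domain monic_chart_base(3)])
      (rule roots_map_in_charts(1)[symmetric])
  from frechet_derivative_at[OF this, symmetric] show ?thesis
    by (simp add: monic_chart_base(2) roots_deriv_def Let_def)
qed

text \<open>The inverse has the polynomial lift \<open>cubic_of\<close>, so no derivative of a root
  is involved in this direction.\<close>

lemma smooth_inverse_base:
  "smooth_in_charts finite_chart monic_chart (inv_into UTH2_Coefs roots_map) roots_base"
proof (rule smooth_in_charts_lift[OF quotient_chart_finite quotient_chart_monic, where F=cubic_of])
  have inv: "inv_into UTH2_Coefs roots_map (rootset h) = RP3 (cubic_of h)" if "h \<in> root_data" for h
    using bij_betw_inv_into_left[OF bij_betw_roots_map, of "RP3 (cubic_of h)"] that
    by (simp add: roots_map_cubic_of UTH2_Coefs_cubic_of)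
  show "inv_into UTH2_Coefs roots_map (rootset h) = RP3 (cubic_of h)" if "h \<in> root_data" for h
    using inv[OF that] .
  show "inv_into UTH2_Coefs roots_map roots_base \<in> chart_dom monic_chart"
    using inv[OF rootset_base(2)] monic_chart_base(1) by (simp add: rootset_base(1) coefs_base_eq)
  show "roots_base \<in> chart_dom finite_chart"
    using homogeneous_manifold.c0[OF homogeneous_manifold_roots] by (simp add: charts_at_def)
qed (simp_all add: disc_cubic_of_neg smooth_cubic_of open_root_data)

theorem proposition4p26:
  shows "riemannian_isometry UTH2_Coefs coefs_atlas coefs_metric
           UTH2_Roots roots_atlas roots_metric roots_map"
proof -
  interpret equivariant_map UTH2_Coefs coefs_atlas coefs_act coefs_base monic_chart
    UTH2_Roots roots_atlas roots_act roots_base finite_chart roots_map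
  proof (intro equivariant_map.intro homogeneous_manifold_coefs homogeneous_manifold_roots)
    show "equivariant_map_axioms UTH2_Coefs coefs_act coefs_base monic_chart UTH2_Roots roots_act
        roots_base finite_chart roots_map"
      using bij_betw_apply[OF bij_betw_roots_map]
      by unfold_locales (simp_all add: roots_map_coefs_act roots_map_base smooth_roots_map_base)
  qed
  \<comment> \<open>The shift \<open>- w\<close> of the real root accounts for
    \<open>w * w'\<close>; the real and imaginary shifts of the upper root account for the terms in
    \<open>(u - w) / 2\<close> and \<open>v / 2\<close>.\<close>
  have "inner (chart_deriv monic_chart finite_chart roots_map coefs_base \<xi>)
      (chart_deriv monic_chart finite_chart roots_map coefs_base \<eta>) = coefs_inner \<xi> \<eta>" for \<xi> \<eta>
    by (cases \<xi>; cases \<eta>) (simp add: chart_deriv_roots_map_base inner_complex_def algebra_simps)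
  then show ?thesis
    unfolding coefs_metric_def roots_metric_def
    by (rule riemannian_isometry_translated_metric[OF bij_betw_roots_map smooth_inverse_base])
qed

end
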